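(* For $\theta\in[-\pi/2,\pi/2]$ let $\mathcal{L}_\theta f(\rho)=\int_0^\infty f(t)\,e^{-\rho t e^{i\theta}}\,dt$, $\rho>0$. (a) For any $\theta\in[-\pi/2,\pi/2]$ there is a constant $K_1(\theta)$ such that for every $f\in L^1(\mathbb{R}_+)\cap L^2(\mathbb{R}_+)$, $$\|\mathcal{L}_\theta f\|_{L^2(\mathbb{R}_+)}\le K_1(\theta)\,\|f\|_{L^2(\mathbb{R}_+)}.$$ Thus $\mathcal{L}_\theta$ extends by continuity to a bounded operator $L^2(\mathbb{R}_+)\to L^2(\mathbb{R}_+)$. (b) The best possible constants $K_1(\theta)=\|\mathcal{L}_\theta\|_{L^2(\mathbb{R}_+)\to L^2(\mathbb{R}_+)}$ are: for $|\theta|<\pi/2$, $$K_1(\theta)=\sqrt{\pi}\,(1-\mu)^{(1-\mu)/4}\,(1+\mu)^{(1+\mu)/4},\qquad \mu=\frac{|\theta|}{\pi/2},$$ and for $|\theta|=\pi/2$, $K_1(\pm\pi/2)=\sqrt{2\pi}$. (c) The even function $K_1(\theta)$ is increasing and continuous on $[0,\pi/2]$; in particular $$\sup_{|\theta|\le\pi/2}K_1(\theta)=\sqrt{2\pi}.$$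
   Context: $\mathbb{R}_+=(0,\infty)$ with Lebesgue measure; functions are complex-valued. *)

theory Defs
  imports "HOL-Analysis.Analysis"
begin

abbreviation Rplus :: "real measure" where
  "Rplus \<equiv> lebesgue_on {0<..}"

text \<open>
  The spaces \<open>L\<^sup>1\<close> and \<open>L\<^sup>2\<close> over the positive half-line are represented by sets of
  functions; their elements are identified up to equality almost everywhere, and values at
  nonpositive arguments are irrelevant.
\<close>

definition L1 :: "(real \<Rightarrow> complex) set" where
  "L1 = {f. integrable Rplus f}"

definition L2 :: "(real \<Rightarrow> complex) set" where
  "L2 = {f. f \<in> borel_measurable Rplus \<and> integrable Rplus (\<lambda>x. (cmod (f x))\<^sup>2)}"

definition L2_norm :: "(real \<Rightarrow> complex) \<Rightarrow> real" where
  "L2_norm f = sqrt (\<integral>x. (cmod (f x))\<^sup>2 \<partial>Rplus)"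

definition laplace :: "real \<Rightarrow> (real \<Rightarrow> complex) \<Rightarrow> real \<Rightarrow> complex" where
  "laplace \<theta> f \<rho> =
     (\<integral>t. f t * exp (- (complex_of_real (\<rho> * t) * exp (\<i> * complex_of_real \<theta>))) \<partial>Rplus)"

text \<open>
  Membership in \<open>L2\<close> is required explicitly because the Bochner integral in \<open>L2_norm\<close>
  is \<open>0\<close> for functions that are not square integrable.
\<close>

definition laplace_bound :: "real \<Rightarrow> real \<Rightarrow> bool" where
  "laplace_bound \<theta> K \<longleftrightarrow>
     (\<forall>f \<in> L1 \<inter> L2. laplace \<theta> f \<in> L2 \<and> L2_norm (laplace \<theta> f) \<le> K * L2_norm f)"

definition K1 :: "real \<Rightarrow> real" where
  "K1 \<theta> = Inf {K. laplace_bound \<theta> K}"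

text \<open>Operators on \<open>L\<^sup>2\<close> act on representatives, compatibly with equality almost everywhere.\<close>

definition bounded_L2_operator :: "((real \<Rightarrow> complex) \<Rightarrow> (real \<Rightarrow> complex)) \<Rightarrow> bool" where
  "bounded_L2_operator T \<longleftrightarrow>
     (\<forall>f\<in>L2. T f \<in> L2) \<and>
     (\<forall>f\<in>L2. \<forall>g\<in>L2. (AE x in Rplus. f x = g x) \<longrightarrow> (AE x in Rplus. T f x = T g x)) \<and>
     (\<forall>f\<in>L2. \<forall>g\<in>L2. AE x in Rplus. T (\<lambda>y. f y + g y) x = T f x + T g x) \<and>
     (\<forall>c. \<forall>f\<in>L2. AE x in Rplus. T (\<lambda>y. c * f y) x = c * T f x) \<and>
     (\<exists>C. \<forall>f\<in>L2. L2_norm (T f) \<le> C * L2_norm f)"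

text \<open>
  The operator norm, in the form of the library's \<open>onorm\<close>; the quotient is \<open>0\<close> when
  \<open>f\<close> vanishes almost everywhere.
\<close>

definition L2_onorm :: "((real \<Rightarrow> complex) \<Rightarrow> (real \<Rightarrow> complex)) \<Rightarrow> real" where
  "L2_onorm T = (SUP f\<in>L2. L2_norm (T f) / L2_norm f)"

definition laplace_extension ::
  "real \<Rightarrow> ((real \<Rightarrow> complex) \<Rightarrow> (real \<Rightarrow> complex)) \<Rightarrow> bool" where
  "laplace_extension \<theta> T \<longleftrightarrow>
     bounded_L2_operator T \<and>
     (\<forall>f \<in> L1 \<inter> L2. AE \<rho> in Rplus. T f \<rho> = laplace \<theta> f \<rho>)"

end

theory Submission
  imports Defs "HOL-Real_Asymp.Real_Asymp"
begin

text \<open>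
  For \<open>\<bar>\<theta>\<bar> < \<pi>/2\<close>, expanding the square writes \<open>\<parallel>L f\<parallel>\<^sup>2\<close> as the double integral of
  \<open>f(s) cnj(f(t)) / (s exp(\<i>\<theta>) + t exp(-\<i>\<theta>))\<close>. The kernel is homogeneous of degree \<open>-1\<close>, so the Mellin
  transform \<open>M\<close> on the critical line diagonalises it: \<open>\<parallel>L f\<parallel>\<^sup>2 = \<integral> w(\<xi>) \<bar>M f(\<xi>)\<bar>\<^sup>2 d\<xi>\<close> with
  \<open>w(\<xi>) = exp(2\<theta>\<xi>) / (2 cosh(\<pi>\<xi>))\<close>. This rests on the Fourier self-duality of the hyperbolic secant, a
  form of the reflection formula for \<open>\<Gamma>\<close>. As \<open>\<integral> \<bar>M f\<bar>\<^sup>2 \<le> 2\<pi> \<parallel>f\<parallel>\<^sup>2\<close>, the squared norm of \<open>L\<close>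
  is at most \<open>2\<pi> sup w\<close>, and the supremum comes from weighted AM--GM. For truncations of the powers
  \<open>t powr (\<epsilon> - 1/2 + \<i>\<xi>)\<close> to \<open>(0, 1)\<close>, \<open>\<bar>M f\<bar>\<^sup>2\<close> is a Poisson kernel concentrating at \<open>\<xi>\<close>, so the bound is sharp.
  At \<open>\<bar>\<theta>\<bar> = \<pi>/2\<close> the upper bound follows from Fatou's lemma, and the damped oscillations
  \<open>exp(-t + \<i>\<omega>t)\<close> with \<open>\<omega> \<rightarrow> \<infinity>\<close> are extremal.
\<close>

section \<open>Lebesgue measure on the positive half-line\<close>

text \<open>The obstacle is Fubini. Expanding the square is legitimate when f(t) / sqrt t is
  integrable, which can fail near 0 for f in L1 and L2; and at \<theta> = pi / 2 the kernel 1 / (s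
  exp(i \<theta>) + t exp(- i \<theta>)) turns into 1 / (i (s - t)), which is not absolutely
  integrable. Hence the exact identity is proved for functions cut off near 0 and for interior
  angles, and one limit, which shrinks the cut-off and moves the angle at the same time, reaches all
  f and the boundary angles. The sharp constant survives this limit because it is continuous up to
  the boundary. At \<theta> = pi / 2 the weight would be 1 / (1 + exp(- 2 pi \<xi>)). Its supremum 1
  is approached only as \<xi> tends to infinity, which is why the extremal functions change there
  from powers to oscillations of growing frequency.\<close>

lemma sigma_finite_measure_completion:
  assumes "sigma_finite_measure M"
  shows "sigma_finite_measure (completion M)"
proof -
  interpret sigma_finite_measure M by fact
  obtain A where A: "countable A" "A \<subseteq> sets M" "\<Union>A = space M" "\<forall>a\<in>A. emeasure M a \<noteq> \<infinity>"
    using sigma_finite_countable by blast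
  show ?thesis
  proof
    show "\<exists>B. countable B \<and> B \<subseteq> sets (completion M) \<and> \<Union>B = space (completion M)
        \<and> (\<forall>a\<in>B. emeasure (completion M) a \<noteq> \<infinity>)"
      using A by (intro exI[of _ A]) (auto simp: sets_completionI_sets subset_iff)
  qed
qed

lemma sigma_finite_Rplus: "sigma_finite_measure Rplus"
  by (intro sigma_finite_measure_restrict_space sigma_finite_measure_completion sigma_finite_lborel) simp

interpretation Rplus: sigma_finite_measure Rplus
  by (rule sigma_finite_Rplus)

interpretation Rplus_pair: pair_sigma_finite Rplus Rplus ..

lemma borel_measurable_RplusI:
  "f \<in> borel_measurable borel \<Longrightarrow> f \<in> borel_measurable Rplus"
  by (simp add: borel_measurable_if_D measurable_completion measurable_restrict_space1)

lemma measurable_ident_Rplus: "(\<lambda>x. x) \<in> borel_measurable Rplus"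
  by (rule borel_measurable_RplusI) simp

text \<open>\<open>Rplus\<close> restricts the completed measure, whereas improper integrals are
  evaluated through \<open>lborel\<close>. For Borel functions the two agree; explicit integrals
  over the half-line are obtained this way.\<close>

lemma integrable_Rplus_iff:
  fixes f :: "real \<Rightarrow> 'a::{banach, second_countable_topology}"
  assumes "set_borel_measurable borel {0<..} f"
  shows "integrable Rplus f \<longleftrightarrow> set_integrable lborel {0<..} f"
  using assms
  by (simp add: integrable_restrict_space set_integrable_def integrable_completion set_borel_measurable_def)

lemma integral_Rplus:
  fixes f :: "real \<Rightarrow> 'a::{banach, second_countable_topology}"
  assumes "set_borel_measurable borel {0<..} f"
  shows "(\<integral>x. f x \<partial>Rplus) = (LINT x:{0<..}|lborel. f x)"
  using assms
  by (simp add: integral_restrict_space set_lebesgue_integral_def integral_completion set_borel_measurable_def)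

section \<open>Squares of integrals as double integrals\<close>

lemma borel_measurable_cnj [measurable]: "cnj \<in> borel_measurable borel"
  by (intro borel_measurable_continuous_onI continuous_intros)

lemma integrable_product_mult:
  fixes f g :: "'a \<Rightarrow> complex"
  assumes "sigma_finite_measure M" and f: "integrable M f" and g: "integrable M g"
  shows "integrable (M \<Otimes>\<^sub>M M) (\<lambda>p. f (fst p) * g (snd p))"
    and "(\<integral>p. f (fst p) * g (snd p) \<partial>(M \<Otimes>\<^sub>M M)) = (\<integral>x. f x \<partial>M) * (\<integral>x. g x \<partial>M)"
proof -
  interpret M: sigma_finite_measure M by fact
  interpret P: pair_sigma_finite M M ..
  have [measurable]: "f \<in> borel_measurable M" "g \<in> borel_measurable M" using f g by auto
  show *: "integrable (M \<Otimes>\<^sub>M M) (\<lambda>p. f (fst p) * g (snd p))"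
    using f g by (intro P.Fubini_integrable) (auto simp: norm_mult)
  show "(\<integral>p. f (fst p) * g (snd p) \<partial>(M \<Otimes>\<^sub>M M)) = (\<integral>x. f x \<partial>M) * (\<integral>x. g x \<partial>M)"
    using P.integral_fst'[OF *] by simp
qed

text \<open>The squared modulus of an integral is the double integral of
  \<open>G s r * cnj (G t r)\<close>, and Fubini moves the r-integral inside. The majorant
  \<open>a s * a t\<close> has one factor per variable, so integrability of \<open>a\<close> gives
  integrability over the product. It is instantiated with the Laplace kernel and with the Mellin
  kernel; equating the two results is the diagonalisation.\<close>

lemma quadratic_form_integral:
  fixes G :: "'a \<Rightarrow> 'b \<Rightarrow> complex" and a :: "'a \<Rightarrow> real"
  assumes M: "sigma_finite_measure M" and N: "sigma_finite_measure N"
    and G [measurable]: "(\<lambda>(s, r). G s r) \<in> borel_measurable (M \<Otimes>\<^sub>M N)"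
    and G_int: "\<And>r. r \<in> space N \<Longrightarrow> integrable M (\<lambda>s. G s r)"
    and a: "integrable M a"
    and GG_int: "\<And>s t. s \<in> space M \<Longrightarrow> t \<in> space M \<Longrightarrow> integrable N (\<lambda>r. G s r * cnj (G t r))"
    and le: "\<And>s t. s \<in> space M \<Longrightarrow> t \<in> space M \<Longrightarrow>
       (\<integral>r. cmod (G s r * cnj (G t r)) \<partial>N) \<le> a s * a t"
  shows "integrable N (\<lambda>r. (cmod (\<integral>s. G s r \<partial>M))\<^sup>2)"
    and "complex_of_real (\<integral>r. (cmod (\<integral>s. G s r \<partial>M))\<^sup>2 \<partial>N) =
      (\<integral>p. (\<integral>r. G (fst p) r * cnj (G (snd p) r) \<partial>N) \<partial>(M \<Otimes>\<^sub>M M))"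
proof -
  interpret M: sigma_finite_measure M by fact
  interpret N: sigma_finite_measure N by fact
  interpret MM: pair_sigma_finite M M ..
  interpret MMN: pair_sigma_finite "M \<Otimes>\<^sub>M M" N ..
  have [measurable]: "a \<in> borel_measurable M" using a by auto
  define H where "H p r = G (fst p) r * cnj (G (snd p) r)" for p r
  have H_meas [measurable]: "(\<lambda>(p, r). H p r) \<in> borel_measurable ((M \<Otimes>\<^sub>M M) \<Otimes>\<^sub>M N)"
  proof -
    have "(\<lambda>z. (\<lambda>(s, r). G s r) (fst (fst z), snd z) * cnj ((\<lambda>(s, r). G s r) (snd (fst z), snd z)))
       \<in> borel_measurable ((M \<Otimes>\<^sub>M M) \<Otimes>\<^sub>M N)"
      by measurable
    then show ?thesis by (simp add: H_def case_prod_beta)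
  qed
  have H_int: "integrable ((M \<Otimes>\<^sub>M M) \<Otimes>\<^sub>M N) (\<lambda>(p, r). H p r)"
  proof (rule MMN.Fubini_integrable)
    have "integrable (M \<Otimes>\<^sub>M M) (\<lambda>p. complex_of_real (a (fst p)) * complex_of_real (a (snd p)))"
      using a by (intro integrable_product_mult M) auto
    then have "integrable (M \<Otimes>\<^sub>M M) (\<lambda>p. a (fst p) * a (snd p))"
      by (simp only: of_real_mult[symmetric] complex_of_real_integrable_eq)
    then show "integrable (M \<Otimes>\<^sub>M M) (\<lambda>p. \<integral>r. norm (case (p, r) of (p, r) \<Rightarrow> H p r) \<partial>N)"
    proof (rule Bochner_Integration.integrable_bound)
      show "AE p in M \<Otimes>\<^sub>M M. norm (\<integral>r. norm (case (p, r) of (p, r) \<Rightarrow> H p r) \<partial>N)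
          \<le> norm (a (fst p) * a (snd p))"
        using le by (intro AE_I2) (auto simp: H_def space_pair_measure intro: order_trans[OF _ abs_ge_self])
    qed simp
    show "AE p in M \<Otimes>\<^sub>M M. integrable N (\<lambda>r. case (p, r) of (p, r) \<Rightarrow> H p r)"
      using GG_int by (intro AE_I2) (auto simp: H_def space_pair_measure)
  qed simp
  have eq: "(\<integral>p. H p r \<partial>(M \<Otimes>\<^sub>M M)) = complex_of_real ((cmod (\<integral>s. G s r \<partial>M))\<^sup>2)" if "r \<in> space N" for r
    unfolding H_def using G_int[OF that]
    by (subst integrable_product_mult(2)[OF M, where g = "\<lambda>t. cnj (G t r)"])
       (auto simp: complex_norm_square[symmetric])
  have "integrable N (\<lambda>r. complex_of_real ((cmod (\<integral>s. G s r \<partial>M))\<^sup>2))"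
    using MMN.integrable_snd[OF H_int] by (subst Bochner_Integration.integrable_cong[OF refl eq[symmetric]])
  then show "integrable N (\<lambda>r. (cmod (\<integral>s. G s r \<partial>M))\<^sup>2)"
    by (simp only: complex_of_real_integrable_eq)
  have "complex_of_real (\<integral>r. (cmod (\<integral>s. G s r \<partial>M))\<^sup>2 \<partial>N) = (\<integral>r. (\<integral>p. H p r \<partial>(M \<Otimes>\<^sub>M M)) \<partial>N)"
    by (subst integral_complex_of_real[symmetric], intro Bochner_Integration.integral_cong refl, simp only: eq)
  also have "\<dots> = (\<integral>p. (\<integral>r. H p r \<partial>N) \<partial>(M \<Otimes>\<^sub>M M))"
    using MMN.integral_snd[OF H_int] MMN.integral_fst[OF H_int] by simp
  finally show "complex_of_real (\<integral>r. (cmod (\<integral>s. G s r \<partial>M))\<^sup>2 \<partial>N) =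
      (\<integral>p. (\<integral>r. G (fst p) r * cnj (G (snd p) r) \<partial>N) \<partial>(M \<Otimes>\<^sub>M M))"
    by (simp add: H_def)
qed

section \<open>The Fourier transform of the hyperbolic secant\<close>

text \<open>Euler's integral after t = exp x. In this additive variable a product of two Gamma
  values becomes a double integral with translated factors, through which the reflection formula
  enters.\<close>

lemma Gamma_integral_exp:
  fixes z :: complex
  assumes z: "Re z > 0"
  shows "integrable lborel (\<lambda>x. exp (z * of_real x - of_real (exp x)))"
    and "(\<integral>x. exp (z * of_real x - of_real (exp x)) \<partial>lborel) = Gamma z"
proof -
  define f where "f x = exp (z * of_real x - of_real (exp x))" for x :: real
  define h where "h t = complex_of_real t powr (z - 1) / of_real (exp t)" for t :: real
  have h_eq: "h t = (1 / t) *\<^sub>R f (ln t)" if "t > 0" for t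
    using that by (simp add: h_def f_def powr_def Ln_of_real algebra_simps exp_diff exp_add scaleR_conv_of_real exp_of_real exp_minus field_simps)
  have h_meas: "(\<lambda>t. indicator {0<..} t *\<^sub>R h t) \<in> borel_measurable borel"
    unfolding h_def
    by (intro borel_measurable_continuous_on_indicator continuous_intros) auto
  have h_abs: "h absolutely_integrable_on {0<..}"
    unfolding h_def by (rule absolutely_integrable_Gamma_integral'[OF z])
  then have h_int: "set_integrable lborel {0<..} h"
    using h_meas by (simp add: set_integrable_def integrable_completion)
  have f_cont: "isCont f x" for x unfolding f_def by (intro continuous_intros)
  have norm_f: "cmod (f x) = exp (Re z * x - exp x)" for x
    by (simp add: f_def)
  have lim: "((ereal \<circ> ln \<circ> real_of_ereal) \<longlongrightarrow> - \<infinity>) (at_right 0)"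
    "((ereal \<circ> ln \<circ> real_of_ereal) \<longlongrightarrow> \<infinity>) (at_left \<infinity>)"
    unfolding zero_ereal_def
    by (simp_all add: ereal_tendsto_simps ln_at_0 ln_at_top)
  \<comment> \<open>Integrability has to precede the complex substitution. It comes from the
    modulus, since the substitution rule for nonnegative functions yields integrability as a
    conclusion.\<close>
  have "set_integrable lborel {0<..} (\<lambda>t. cmod (h t))"
    using h_int by (rule set_integrable_norm)
  then have "set_integrable lborel {0<..} (\<lambda>t. exp (Re z * ln t - exp (ln t)) * (1 / t))"
    by (subst (asm) set_integrable_cong[OF refl refl, where f' = "\<lambda>t. exp (Re z * ln t - exp (ln t)) * (1 / t)"])
       (auto simp: h_eq norm_f)
  then have "set_integrable lborel (einterval (- \<infinity>) \<infinity>) (\<lambda>x. exp (Re z * x - exp x))"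
    by (intro interval_integral_substitution_nonneg(1)[of 0 \<infinity> ln "\<lambda>t. 1 / t", OF _ _ _ _ _ _ lim])
       (auto simp: zero_ereal_def intro!: derivative_eq_intros continuous_intros)
  then have "integrable lborel (\<lambda>x. exp (Re z * x - exp x))"
    by (simp add: set_integrable_def)
  then show f_int: "integrable lborel (\<lambda>x. exp (z * of_real x - of_real (exp x)))"
    by (rule Bochner_Integration.integrable_bound) (auto simp: exp_of_real)
  have "(LBINT x=-\<infinity>..\<infinity>. f x) = (LBINT t=0..\<infinity>. (1 / t) *\<^sub>R f (ln t))"
  proof (intro interval_integral_substitution_integrable[OF _ _ _ _ _ lim])
    show "set_integrable lborel (einterval 0 \<infinity>) (\<lambda>t. (1 / t) *\<^sub>R f (ln t))"
      using h_int h_eq by (subst set_integrable_cong[OF refl refl, where f' = h]) (auto simp: zero_ereal_def)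
    show "set_integrable lborel (einterval (- \<infinity>) \<infinity>) f"
      using f_int by (simp add: set_integrable_def f_def)
  qed (auto simp: zero_ereal_def f_cont intro!: derivative_eq_intros continuous_intros)
  also have "\<dots> = (LINT t:{0<..}|lborel. h t)"
    unfolding interval_lebesgue_integral_0_infty
    by (rule set_lebesgue_integral_cong) (auto simp: h_eq)
  also have "\<dots> = (LINT t:{0<..}|lebesgue. h t)"
    using h_meas by (simp add: set_lebesgue_integral_def integral_completion)
  also have "\<dots> = Gamma z"
    unfolding set_lebesgue_integral_eq_integral(2)[OF h_abs] unfolding h_def
    by (rule integral_unique[OF Gamma_integral_complex'[OF z]])
  finally show "(\<integral>x. exp (z * of_real x - of_real (exp x)) \<partial>lborel) = Gamma z"
    by (simp add: interval_lebesgue_integral_def set_lebesgue_integral_def f_def)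
qed

text \<open>Euler's integral at z = 1, translated by ln c.\<close>

lemma integral_exp_minus_exp:
  fixes c :: real
  assumes "c > 0"
  shows "(\<integral>x. exp (complex_of_real x - of_real (c * exp x)) \<partial>lborel) = 1 / of_real c"
proof -
  have "1 = (\<integral>x. exp (complex_of_real x - of_real (exp x)) \<partial>lborel)"
    using Gamma_integral_exp(2)[of 1] by simp
  also have "\<dots> = (\<integral>x. exp (complex_of_real (ln c + 1 * x) - of_real (exp (ln c + 1 * x))) \<partial>lborel)"
    using lborel_integral_real_affine[of 1 "\<lambda>x. exp (complex_of_real x - of_real (exp x))" "ln c"] by simp
  also have "\<dots> = (\<integral>x. of_real c * exp (complex_of_real x - of_real (c * exp x)) \<partial>lborel)"
    using assms by (intro Bochner_Integration.integral_cong refl)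
      (simp add: exp_add exp_diff exp_of_real)
  also have "\<dots> = of_real c * (\<integral>x. exp (complex_of_real x - of_real (c * exp x)) \<partial>lborel)"
    by simp
  finally show ?thesis using assms by (simp add: field_simps)
qed

text \<open>This is the beta integral Gamma a * Gamma (1 - a). Writing 1 / (1 + exp y) as the
  x-integral of exp (x - (1 + exp y) exp x) gives the double integral of \<open>F\<close>;
  integrating in y first splits off Gamma a, because the y-integral is a translate of
  Euler's.\<close>

lemma integral_exp_logistic:
  fixes a :: complex
  assumes a: "0 < Re a" "Re a < 1"
  shows "integrable lborel (\<lambda>y. exp (a * of_real y) / (1 + exp (of_real y)))"
    and "(\<integral>y. exp (a * of_real y) / (1 + exp (of_real y)) \<partial>lborel) = of_real pi / sin (of_real pi * a)"
proof -
  define b where "b = 1 - a"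
  have b: "Re b > 0" using a by (simp add: b_def)
  define F where "F x y = exp (of_real x - of_real ((1 + exp y) * exp x)) * exp (a * of_real y)"
    for x y :: real
  have F_eq: "F x y = exp (b * of_real x - of_real (exp x)) *
      exp (a * of_real (x + 1 * y) - of_real (exp (x + 1 * y)))" for x y
  proof -
    have "complex_of_real (exp (x + 1 * y)) = of_real (exp x) * of_real (exp y)"
      by (simp add: exp_add)
    then show ?thesis
      unfolding F_def mult_exp_exp by (simp add: b_def algebra_simps)
  qed
  have shift_int: "integrable lborel (\<lambda>y. exp (a * of_real (x + 1 * y) - of_real (exp (x + 1 * y))))" for x :: real
    using lborel_integrable_real_affine[OF Gamma_integral_exp(1)[OF a(1)], of 1 x] by simp
  have shift: "(\<integral>y. exp (a * of_real (x + 1 * y) - of_real (exp (x + 1 * y))) \<partial>lborel) = Gamma a" for x :: real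
    using lborel_integral_real_affine[of 1 "\<lambda>y. exp (a * of_real y - of_real (exp y))" x]
      Gamma_integral_exp(2)[OF a(1)] by simp
  have shift_norm: "(\<integral>y. cmod (exp (a * of_real (x + 1 * y) - of_real (exp (x + 1 * y)))) \<partial>lborel)
      = (\<integral>y. cmod (exp (a * of_real y - of_real (exp y))) \<partial>lborel)" for x :: real
    using lborel_integral_real_affine[of 1 "\<lambda>y. cmod (exp (a * of_real y - of_real (exp y)))" x] by simp
  have F_int: "integrable (lborel \<Otimes>\<^sub>M lborel) (\<lambda>(x, y). F x y)"
  proof (rule lborel_pair.Fubini_integrable)
    show "(\<lambda>(x, y). F x y) \<in> borel_measurable (lborel \<Otimes>\<^sub>M lborel)"
      unfolding F_def by measurable
    have "integrable lborel (\<lambda>x. cmod (exp (b * of_real x - of_real (exp x))) *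
        (\<integral>y. cmod (exp (a * of_real y - of_real (exp y))) \<partial>lborel))"
      using Gamma_integral_exp(1)[OF b] by (intro integrable_mult_left integrable_norm)
    then show "integrable lborel (\<lambda>x. \<integral>y. norm (case (x, y) of (x, y) \<Rightarrow> F x y) \<partial>lborel)"
      unfolding prod.case F_eq norm_mult integral_mult_right_zero shift_norm .
    show "AE x in lborel. integrable lborel (\<lambda>y. case (x, y) of (x, y) \<Rightarrow> F x y)"
      unfolding prod.case F_eq by (intro AE_I2 integrable_mult_right shift_int)
  qed
  have inner: "(\<integral>x. F x y \<partial>lborel) = exp (a * of_real y) / (1 + exp (of_real y))" for y
    using integral_exp_minus_exp[of "1 + exp y"] unfolding F_def
    by (simp add: exp_of_real add_pos_pos)
  show "integrable lborel (\<lambda>y. exp (a * of_real y) / (1 + exp (of_real y)))"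
    using lborel_pair.integrable_snd[OF F_int] unfolding inner .
  have "(\<integral>y. exp (a * of_real y) / (1 + exp (of_real y)) \<partial>lborel)
      = (\<integral>x. (\<integral>y. F x y \<partial>lborel) \<partial>lborel)"
    using lborel_pair.Fubini_integral[OF F_int] unfolding inner by simp
  also have "\<dots> = (\<integral>x. exp (b * of_real x - of_real (exp x)) * Gamma a \<partial>lborel)"
    unfolding F_eq integral_mult_right_zero shift ..
  also have "\<dots> = Gamma b * Gamma a"
    using Gamma_integral_exp(2)[OF b] by simp
  also have "\<dots> = of_real pi / sin (of_real pi * a)"
    using Gamma_reflection_complex[of a] by (simp add: b_def mult.commute)
  finally show "(\<integral>y. exp (a * of_real y) / (1 + exp (of_real y)) \<partial>lborel) = of_real pi / sin (of_real pi * a)" .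
qed

text \<open>
  \<open>2 * pi * mellin_weight \<theta> \<xi>\<close> is the squared modulus of the Mellin multiplier
  \<open>\<Gamma>(1/2 + \<i>\<xi>) exp(-\<i>\<theta>(1/2 + \<i>\<xi>))\<close> of the transform.
\<close>

definition mellin_weight :: "real \<Rightarrow> real \<Rightarrow> real" where
  "mellin_weight \<theta> \<xi> = exp (2 * \<theta> * \<xi>) / (2 * cosh (pi * \<xi>))"

text \<open>The kernel of the squared Laplace norm is recognised here: with u = ln s - ln t, s exp(i
  \<theta>) + t exp(- i \<theta>) equals sqrt (s t) times 2 cos (\<theta> - i u / 2). At \<theta> =
  0 the same formula supplies the damping factor for the Plancherel inequality.\<close>

lemma fourier_mellin_weight:
  assumes \<theta>: "\<bar>\<theta>\<bar> < pi / 2"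
  shows "integrable lborel (mellin_weight \<theta>)"
    and "(\<integral>\<xi>. mellin_weight \<theta> \<xi> * exp (- (\<i> * of_real (\<xi> * u))) \<partial>lborel) =
      1 / (2 * cos (of_real \<theta> - \<i> * of_real u / 2))"
proof -
  \<comment> \<open>Expanding the weight by exp (pi \<xi>) puts 1 + exp (2 pi \<xi>) in the
    denominator; with y = 2 pi \<xi> the exponent of the numerator becomes \<open>a v * y\<close>.
    The condition on \<theta> says exactly that \<open>Re (a v)\<close> lies in (0, 1).\<close>
  define a where "a v = 1 / 2 + (2 * of_real \<theta> - \<i> * of_real v) / (2 * of_real pi)" for v :: real
  have a: "0 < Re (a v)" "Re (a v) < 1" for v
    using \<theta> by (auto simp: a_def field_simps abs_if split: if_splits)
  have eq: "complex_of_real (mellin_weight \<theta> \<xi>) * exp (- (\<i> * of_real (\<xi> * v))) =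
      exp (a v * of_real (0 + 2 * pi * \<xi>)) / (1 + exp (of_real (0 + 2 * pi * \<xi>)))" for \<xi> v
  proof -
    have 1: "complex_of_real (mellin_weight \<theta> \<xi>) =
       exp (of_real (2 * \<theta> * \<xi> + pi * \<xi>)) / (1 + exp (of_real (2 * pi * \<xi>)))"
    proof -
      have "1 + exp (2 * pi * \<xi>) = exp (pi * \<xi>) * (2 * cosh (pi * \<xi>))"
        by (simp add: cosh_def algebra_simps exp_add[symmetric] exp_minus field_simps)
      then have "mellin_weight \<theta> \<xi> = exp (2 * \<theta> * \<xi> + pi * \<xi>) / (1 + exp (2 * pi * \<xi>))"
        by (simp add: mellin_weight_def exp_add)
      then show ?thesis by (simp flip: exp_of_real)
    qed
    have 2: "a v * of_real (0 + 2 * pi * \<xi>) = of_real (2 * \<theta> * \<xi> + pi * \<xi>) - \<i> * of_real (\<xi> * v)"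
      by (simp add: a_def field_simps)
    show ?thesis unfolding 1 2 by (simp add: exp_diff exp_minus field_simps)
  qed
  have int: "integrable lborel (\<lambda>\<xi>. complex_of_real (mellin_weight \<theta> \<xi>) * exp (- (\<i> * of_real (\<xi> * v))))" for v
    unfolding eq using lborel_integrable_real_affine[OF integral_exp_logistic(1)[OF a], of "2 * pi" v 0]
    by simp
  show "integrable lborel (mellin_weight \<theta>)"
    using int[of 0] by (simp add: complex_of_real_integrable_eq)
  have "of_real (2 * pi) * (\<integral>\<xi>. mellin_weight \<theta> \<xi> * exp (- (\<i> * of_real (\<xi> * u))) \<partial>lborel)
      = of_real pi / sin (of_real pi * a u)"
    unfolding eq integral_exp_logistic(2)[OF a, symmetric]
    by (subst lborel_integral_real_affine[where c = "2 * pi" and t = 0]) (auto simp: scaleR_conv_of_real)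
  moreover have "sin (of_real pi * a u) = cos (of_real \<theta> - \<i> * of_real u / 2)"
  proof -
    have "of_real pi * a u = of_real pi / 2 + (of_real \<theta> - \<i> * of_real u / 2)"
      by (simp add: a_def field_simps)
    then show ?thesis
      by (simp add: sin_add flip: of_real_divide sin_of_real cos_of_real) 
  qed
  \<comment> \<open>The case c = 0 is settled by x / 0 = 0.\<close>
  moreover have "X = 1 / (2 * c)" if "of_real (2 * pi) * X = of_real pi / c" for X c :: complex
    using that by (cases "c = 0") (auto simp: field_simps)
  ultimately show "(\<integral>\<xi>. mellin_weight \<theta> \<xi> * exp (- (\<i> * of_real (\<xi> * u))) \<partial>lborel) =
      1 / (2 * cos (of_real \<theta> - \<i> * of_real u / 2))"
    by simp
qed

section \<open>The Laplace transform in Mellin coordinates\<close>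

text \<open>The Mellin transform \<integral> f(t) t^(s - 1) dt on the line s = 1/2 - i \<xi>,
  unnormalised, whence the factor 2 pi in the Plancherel inequality. It is a genuine integral when
  f(t) / sqrt t is integrable, the recurring hypothesis \<open>f_int\<close>.\<close>

definition mellin :: "(real \<Rightarrow> complex) \<Rightarrow> real \<Rightarrow> complex" where
  "mellin f \<xi> = (\<integral>t. f t * exp (- ((1 / 2 + \<i> * of_real \<xi>) * of_real (ln t))) \<partial>Rplus)"

text \<open>In the variable ln t the Mellin transform is a Fourier transform, so a weight w in \<xi>
  becomes a convolution kernel, the Fourier transform of w at ln s - ln t. One instance is the
  Laplace weight, the other the damping factor behind Plancherel.\<close>

lemma mellin_weighted_norm:
  fixes w :: "real \<Rightarrow> real"
  assumes w: "integrable lborel w" "\<And>\<xi>. w \<xi> \<ge> 0"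
    and f [measurable]: "f \<in> borel_measurable Rplus"
    and f_int: "integrable Rplus (\<lambda>t. cmod (f t) * exp (- ln t / 2))"
  shows "integrable lborel (\<lambda>\<xi>. w \<xi> * (cmod (mellin f \<xi>))\<^sup>2)"
    and "complex_of_real (\<integral>\<xi>. w \<xi> * (cmod (mellin f \<xi>))\<^sup>2 \<partial>lborel) =
      (\<integral>p. f (fst p) * cnj (f (snd p)) * of_real (exp (- (ln (fst p) + ln (snd p)) / 2)) *
         (\<integral>\<xi>. w \<xi> * exp (- (\<i> * of_real (\<xi> * (ln (fst p) - ln (snd p))))) \<partial>lborel)
       \<partial>(Rplus \<Otimes>\<^sub>M Rplus))"
proof -
  have [measurable]: "w \<in> borel_measurable borel" using w(1) by auto
  \<comment> \<open>The weight is split as sqrt w * sqrt w, so that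
    \<open>G s \<xi> * cnj (G t \<xi>)\<close> carries w once.\<close>
  define G where "G s \<xi> = f s * exp (- ((1 / 2 + \<i> * of_real \<xi>) * of_real (ln s))) * of_real (sqrt (w \<xi>))"
    for s \<xi> :: real
  \<comment> \<open>Scaled so that \<open>a s * a t\<close> equals the \<xi>-integral of the modulus
    exactly.\<close>
  define a where "a s = cmod (f s) * exp (- ln s / 2) * sqrt (\<integral>\<xi>. w \<xi> \<partial>lborel)" for s
  have W: "(\<integral>\<xi>. w \<xi> \<partial>lborel) \<ge> 0" using w(2) by simp
  have GG: "G s \<xi> * cnj (G t \<xi>) = f s * cnj (f t) * of_real (exp (- (ln s + ln t) / 2)) *
      (w \<xi> * exp (- (\<i> * of_real (\<xi> * (ln s - ln t)))))" for s t \<xi>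
  proof -
    have "G s \<xi> * cnj (G t \<xi>) = f s * cnj (f t) * (of_real (sqrt (w \<xi>)) * of_real (sqrt (w \<xi>))) *
      (exp (- ((1 / 2 + \<i> * of_real \<xi>) * of_real (ln s))) *
       exp (- ((1 / 2 - \<i> * of_real \<xi>) * of_real (ln t))))"
      by (simp add: G_def exp_cnj)
    also have "of_real (sqrt (w \<xi>)) * of_real (sqrt (w \<xi>)) = complex_of_real (w \<xi>)"
      using w(2)[of \<xi>] by (simp flip: of_real_mult)
    also have "exp (- ((1 / 2 + \<i> * of_real \<xi>) * of_real (ln s))) *
        exp (- ((1 / 2 - \<i> * of_real \<xi>) * of_real (ln t)))
       = of_real (exp (- (ln s + ln t) / 2)) * exp (- (\<i> * of_real (\<xi> * (ln s - ln t))))"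
      unfolding mult_exp_exp exp_of_real[symmetric]
      by (rule arg_cong[where f = exp]) (simp add: field_simps)
    finally show ?thesis by (simp add: mult_ac)
  qed
  have norm_GG: "cmod (G s \<xi> * cnj (G t \<xi>)) =
      cmod (f s) * cmod (f t) * exp (- (ln s + ln t) / 2) * w \<xi>" for s t \<xi>
    unfolding GG using w(2) by (simp add: norm_mult)
  have norm_G: "cmod (G s \<xi>) = sqrt (w \<xi>) * (cmod (f s) * exp (- ln s / 2))" for s \<xi>
    using w(2) by (simp add: G_def norm_mult)
  note * = quadratic_form_integral[where M = Rplus and N = lborel and G = G and a = a,
      OF sigma_finite_Rplus sigma_finite_lborel]
  have G_meas: "(\<lambda>(s, \<xi>). G s \<xi>) \<in> borel_measurable (Rplus \<Otimes>\<^sub>M lborel)"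
  proof -
    note measurable_ident_Rplus [measurable]
    show ?thesis unfolding G_def by measurable
  qed
  have G_int: "integrable Rplus (\<lambda>s. G s \<xi>)" for \<xi>
  proof (rule Bochner_Integration.integrable_bound)
    show "integrable Rplus (\<lambda>s. sqrt (w \<xi>) * (cmod (f s) * exp (- ln s / 2)))"
      using f_int by simp
    note measurable_ident_Rplus [measurable]
    show "(\<lambda>s. G s \<xi>) \<in> borel_measurable Rplus" unfolding G_def by measurable
  qed (use w(2) in \<open>auto simp: norm_G\<close>)
  have a_int: "integrable Rplus a" unfolding a_def using f_int by simp
  have GG_int: "integrable lborel (\<lambda>\<xi>. G s \<xi> * cnj (G t \<xi>))" for s t
  proof (rule Bochner_Integration.integrable_bound)
    show "integrable lborel (\<lambda>\<xi>. cmod (f s) * cmod (f t) * exp (- (ln s + ln t) / 2) * w \<xi>)"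
      using w(1) by simp
    show "(\<lambda>\<xi>. G s \<xi> * cnj (G t \<xi>)) \<in> borel_measurable lborel" unfolding GG by measurable
  qed (use w(2) in \<open>auto simp: norm_GG\<close>)
  have le: "(\<integral>\<xi>. cmod (G s \<xi> * cnj (G t \<xi>)) \<partial>lborel) \<le> a s * a t" for s t
  proof -
    have "exp (- (ln s + ln t) / 2) = exp (- ln s / 2) * exp (- ln t / 2)"
      unfolding exp_add[symmetric] by (rule arg_cong[where f = exp]) (simp add: field_simps)
    moreover have "a s * a t = cmod (f s) * cmod (f t) * (exp (- ln s / 2) * exp (- ln t / 2)) *
        (sqrt (\<integral>\<xi>. w \<xi> \<partial>lborel) * sqrt (\<integral>\<xi>. w \<xi> \<partial>lborel))"
      by (simp only: a_def mult_ac)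
    ultimately show ?thesis
      unfolding norm_GG using W by simp
  qed
  have mellin_G: "(cmod (\<integral>s. G s \<xi> \<partial>Rplus))\<^sup>2 = w \<xi> * (cmod (mellin f \<xi>))\<^sup>2" for \<xi>
    unfolding G_def mellin_def using w(2) by (simp add: norm_mult power_mult_distrib)
  show "integrable lborel (\<lambda>\<xi>. w \<xi> * (cmod (mellin f \<xi>))\<^sup>2)"
    using *(1)[OF G_meas G_int a_int GG_int le] unfolding mellin_G .
  show "complex_of_real (\<integral>\<xi>. w \<xi> * (cmod (mellin f \<xi>))\<^sup>2 \<partial>lborel) =
      (\<integral>p. f (fst p) * cnj (f (snd p)) * of_real (exp (- (ln (fst p) + ln (snd p)) / 2)) *
         (\<integral>\<xi>. w \<xi> * exp (- (\<i> * of_real (\<xi> * (ln (fst p) - ln (snd p))))) \<partial>lborel)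
       \<partial>(Rplus \<Otimes>\<^sub>M Rplus))"
    using *(2)[OF G_meas G_int a_int GG_int le] unfolding mellin_G GG
    by simp
qed

section \<open>The Laplace norm as a weighted Mellin norm\<close>

lemma integral_exp_decay:
  fixes z :: complex
  assumes z: "Re z > 0"
  shows "integrable Rplus (\<lambda>r. exp (- (of_real r * z)))"
    and "(\<integral>r. exp (- (of_real r * z)) \<partial>Rplus) = 1 / z"
proof -
  have meas: "(\<lambda>r. exp (- (of_real r * z))) \<in> borel_measurable borel" by measurable
  then have smeas: "set_borel_measurable borel {0<..} (\<lambda>r. exp (- (of_real r * z)))"
    by (auto simp: set_borel_measurable_def)
  have lim: "((\<lambda>r. exp (- (Re z * r))) \<longlongrightarrow> 0) at_top" 
    using z by real_asymp
  have "set_integrable lborel (einterval 0 \<infinity>) (\<lambda>r. exp (- (Re z * r)))"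
  proof (rule interval_integral_FTC_nonneg)
    show "DERIV (\<lambda>r. - exp (- (Re z * r)) / Re z) x :> exp (- (Re z * x))" for x
      using z by (auto intro!: derivative_eq_intros)
    show "(((\<lambda>r. - exp (- (Re z * r)) / Re z) \<circ> real_of_ereal) \<longlongrightarrow> - 1 / Re z) (at_right 0)"
      unfolding zero_ereal_def ereal_tendsto_simps using z by (auto intro!: tendsto_eq_intros)
    show "(((\<lambda>r. - exp (- (Re z * r)) / Re z) \<circ> real_of_ereal) \<longlongrightarrow> - 0 / Re z) (at_left \<infinity>)"
      unfolding ereal_tendsto_simps using z by (intro tendsto_intros lim) auto
  qed auto
  then have "set_integrable lborel {0<..} (\<lambda>r. exp (- (Re z * r)))"
    by (simp add: zero_ereal_def)
  then have sint: "set_integrable lborel {0<..} (\<lambda>r. exp (- (of_real r * z)))"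
    by (rule set_integrable_bound) (auto simp: smeas[unfolded set_borel_measurable_def] set_borel_measurable_def mult.commute)
  then show "integrable Rplus (\<lambda>r. exp (- (of_real r * z)))"
    by (simp add: integrable_Rplus_iff smeas)
  have "(LBINT r=0..\<infinity>. exp (- (of_real r * z))) = - 0 / z - (- 1 / z)"
  proof (rule interval_integral_FTC_integrable)
    show "((\<lambda>r. - exp (- (of_real r * z)) / z) has_vector_derivative exp (- (of_real x * z))) (at x)" for x :: real
      by (rule has_vector_derivative_real_field) (use z in \<open>auto intro!: derivative_eq_intros\<close>)
    show "(((\<lambda>r. - exp (- (of_real r * z)) / z) \<circ> real_of_ereal) \<longlongrightarrow> - 1 / z) (at_right 0)"
      unfolding zero_ereal_def ereal_tendsto_simps using z by (auto intro!: tendsto_eq_intros)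
    have "((\<lambda>r. exp (- (of_real r * z))) \<longlongrightarrow> 0) at_top"
      by (rule tendsto_norm_zero_cancel) (use lim in \<open>simp add: mult.commute\<close>)
    then show "(((\<lambda>r. - exp (- (of_real r * z)) / z) \<circ> real_of_ereal) \<longlongrightarrow> - 0 / z) (at_left \<infinity>)"
      unfolding ereal_tendsto_simps using z by (intro tendsto_intros) auto
  qed (use sint in \<open>auto simp: zero_ereal_def intro!: continuous_intros\<close>)
  then show "(\<integral>r. exp (- (of_real r * z)) \<partial>Rplus) = 1 / z"
    by (simp add: integral_Rplus smeas interval_lebesgue_integral_0_infty)
qed

text \<open>Both sides are the same double integral. On the Laplace side the \<rho>-integral of the
  exponentials is 1 / (s exp(i \<theta>) + t exp(- i \<theta>)); on the Mellin side
  \<open>fourier_mellin_weight\<close> produces the same kernel. At interior angles cos \<theta> >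
  0, which gives the majorant that separates s and t.\<close>

lemma laplace_norm_eq_mellin:
  assumes \<theta>: "\<bar>\<theta>\<bar> < pi / 2"
    and f: "integrable Rplus f"
    and f_int: "integrable Rplus (\<lambda>t. cmod (f t) * exp (- ln t / 2))"
  shows "integrable Rplus (\<lambda>\<rho>. (cmod (laplace \<theta> f \<rho>))\<^sup>2)"
    and "(\<integral>\<rho>. (cmod (laplace \<theta> f \<rho>))\<^sup>2 \<partial>Rplus) =
      (\<integral>\<xi>. mellin_weight \<theta> \<xi> * (cmod (mellin f \<xi>))\<^sup>2 \<partial>lborel)"
proof -
  have f_meas [measurable]: "f \<in> borel_measurable Rplus" using f by auto
  have c: "cos \<theta> > 0" using \<theta> by (intro cos_gt_zero_pi) auto
  define G where "G s \<rho> = f s * exp (- (complex_of_real (\<rho> * s) * exp (\<i> * complex_of_real \<theta>)))"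
    for s \<rho> :: real
  \<comment> \<open>From 1 / ((s + t) cos \<theta>) \<le> 1 / (2 sqrt (s t) cos \<theta>), whose
    right-hand side separates into a factor in s and a factor in t.\<close>
  define a where "a s = cmod (f s) * exp (- ln s / 2) / sqrt (2 * cos \<theta>)" for s
  define e where "e = exp (\<i> * complex_of_real \<theta>)"
  have Re_e: "Re e = cos \<theta>" "Re (cnj e) = cos \<theta>" by (auto simp: e_def Re_exp)
  have cnj_e: "cnj e = exp (- (\<i> * complex_of_real \<theta>))" by (simp add: e_def exp_cnj)
  have GG: "G s \<rho> * cnj (G t \<rho>) = f s * cnj (f t) * exp (- (of_real \<rho> * (of_real s * e + of_real t * cnj e)))"
    for s t \<rho>
    by (simp add: G_def exp_cnj e_def[symmetric] algebra_simps exp_add exp_minus exp_diff divide_inverse)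
  have Re_pos: "Re (of_real s * e + of_real t * cnj e) > 0" if "s > 0" "t > 0" for s t
    using that c by (simp add: Re_e add_pos_pos)
  \<comment> \<open>Written as a real part so that the complex formula
    \<open>integral_exp_decay\<close> also evaluates this real integral.\<close>
  have norm_GG: "cmod (G s \<rho> * cnj (G t \<rho>)) =
      cmod (f s) * cmod (f t) * Re (exp (- (of_real \<rho> * of_real ((s + t) * cos \<theta>))))" for s t \<rho>
    unfolding GG norm_mult by (simp add: Re_e Re_exp algebra_simps)
  note * = quadratic_form_integral[where M = Rplus and N = Rplus and G = G and a = a,
      OF sigma_finite_Rplus sigma_finite_Rplus]
  have G_meas: "(\<lambda>(s, \<rho>). G s \<rho>) \<in> borel_measurable (Rplus \<Otimes>\<^sub>M Rplus)"
  proof -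
    note measurable_ident_Rplus [measurable]
    show ?thesis unfolding G_def by measurable
  qed
  have G_int: "integrable Rplus (\<lambda>s. G s \<rho>)" if "\<rho> \<in> space Rplus" for \<rho>
  proof (rule Bochner_Integration.integrable_bound[OF f])
    note measurable_ident_Rplus [measurable]
    show "(\<lambda>s. G s \<rho>) \<in> borel_measurable Rplus" unfolding G_def by measurable
    show "AE s in Rplus. cmod (G s \<rho>) \<le> cmod (f s)"
      using c that by (intro AE_I2) (auto simp: G_def norm_mult Re_exp intro!: mult_left_le)
  qed
  have a_int: "integrable Rplus a" unfolding a_def using f_int by simp
  have GG_int: "integrable Rplus (\<lambda>\<rho>. G s \<rho> * cnj (G t \<rho>))"
    if "s \<in> space Rplus" "t \<in> space Rplus" for s t
    unfolding GG using that by (intro integrable_mult_right integral_exp_decay Re_pos) auto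
  have le: "(\<integral>\<rho>. cmod (G s \<rho> * cnj (G t \<rho>)) \<partial>Rplus) \<le> a s * a t"
    if "s \<in> space Rplus" "t \<in> space Rplus" for s t
  proof -
    have st: "s > 0" "t > 0" using that by auto
    have pos: "0 < Re (of_real ((s + t) * cos \<theta>))" using st c by simp
    have "(\<integral>\<rho>. cmod (G s \<rho> * cnj (G t \<rho>)) \<partial>Rplus) = cmod (f s) * cmod (f t) * (1 / ((s + t) * cos \<theta>))"
      unfolding norm_GG using integral_exp_decay[OF pos]
      by (simp del: of_real_mult of_real_add add: Re_divide_of_real)
    also have "\<dots> \<le> cmod (f s) * cmod (f t) * (exp (- ln s / 2) * exp (- ln t / 2) / (2 * cos \<theta>))"
    proof -
      have e: "exp (- (ln x / 2)) = 1 / sqrt x" if "x > 0" for x :: real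
        using that by (simp add: exp_minus ln_sqrt[symmetric] inverse_eq_divide)
      have "sqrt (s * t) \<le> (s + t) / 2" using st by (intro arith_geo_mean_sqrt) auto
      then have "1 / ((s + t) * cos \<theta>) \<le> 1 / (2 * sqrt (s * t) * cos \<theta>)"
        using st c by (intro divide_left_mono mult_right_mono) auto
      then show ?thesis using st by (intro mult_left_mono) (auto simp: e real_sqrt_mult field_simps)
    qed
    also have "\<dots> = a s * a t" using c by (simp add: a_def)
    finally show ?thesis .
  qed
  have L: "(\<integral>s. G s \<rho> \<partial>Rplus) = laplace \<theta> f \<rho>" for \<rho> by (simp add: G_def laplace_def)
  show "integrable Rplus (\<lambda>\<rho>. (cmod (laplace \<theta> f \<rho>))\<^sup>2)"
    using *(1)[OF G_meas G_int a_int GG_int le] unfolding L .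
  \<comment> \<open>Homogeneity: dividing by the geometric mean of s and t leaves a function of
    their ratio alone.\<close>
  have kernel: "of_real s * e + of_real t * cnj e =
     of_real (exp ((ln s + ln t) / 2)) * (2 * cos (of_real \<theta> - \<i> * of_real (ln s - ln t) / 2))"
    if "s > 0" "t > 0" for s t :: real
  proof -
    define A B where "A = complex_of_real (ln s)" and "B = complex_of_real (ln t)"
    have st: "of_real s = exp A" "of_real t = exp B" using that by (simp_all add: A_def B_def exp_of_real)
    define C where "C = \<i> * (of_real \<theta> - \<i> * of_real (ln s - ln t) / 2)"
    have "of_real (exp ((ln s + ln t) / 2)) = exp ((A + B) / 2)" by (simp add: A_def B_def flip: exp_of_real)
    moreover have "2 * cos (of_real \<theta> - \<i> * of_real (ln s - ln t) / 2) = exp C + exp (- C)"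
      by (simp add: cos_exp_eq C_def)
    moreover have "exp ((A + B) / 2) * exp C = exp A * e" "exp ((A + B) / 2) * exp (- C) = exp B * cnj e"
      unfolding e_def exp_cnj mult_exp_exp
      by (rule arg_cong[where f = exp]; simp add: C_def A_def B_def field_simps)+
    ultimately show ?thesis by (simp only: st distrib_left)
  qed
  have "complex_of_real (\<integral>\<rho>. (cmod (laplace \<theta> f \<rho>))\<^sup>2 \<partial>Rplus) =
    (\<integral>p. (\<integral>\<rho>. G (fst p) \<rho> * cnj (G (snd p) \<rho>) \<partial>Rplus) \<partial>(Rplus \<Otimes>\<^sub>M Rplus))"
    using *(2)[OF G_meas G_int a_int GG_int le] unfolding L .
  also have "\<dots> = (\<integral>p. f (fst p) * cnj (f (snd p)) * of_real (exp (- (ln (fst p) + ln (snd p)) / 2)) *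
         (\<integral>\<xi>. mellin_weight \<theta> \<xi> * exp (- (\<i> * of_real (\<xi> * (ln (fst p) - ln (snd p))))) \<partial>lborel)
       \<partial>(Rplus \<Otimes>\<^sub>M Rplus))"
  proof (rule Bochner_Integration.integral_cong[OF refl])
    fix p assume "p \<in> space (Rplus \<Otimes>\<^sub>M Rplus)"
    then have p: "fst p > 0" "snd p > 0" by (auto simp: space_pair_measure)
    show "(\<integral>\<rho>. G (fst p) \<rho> * cnj (G (snd p) \<rho>) \<partial>Rplus) =
      f (fst p) * cnj (f (snd p)) * of_real (exp (- (ln (fst p) + ln (snd p)) / 2)) *
         (\<integral>\<xi>. mellin_weight \<theta> \<xi> * exp (- (\<i> * of_real (\<xi> * (ln (fst p) - ln (snd p))))) \<partial>lborel)"
    proof -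
      have "a * (1 / (of_real x * y)) = a * of_real (inverse x) * (1 / y)" for a y :: complex and x
        by (simp add: field_simps)
      moreover have "exp (- (ln (fst p) + ln (snd p)) / 2) = inverse (exp ((ln (fst p) + ln (snd p)) / 2))"
        by (simp only: exp_minus minus_divide_left[symmetric])
      ultimately show ?thesis
        unfolding GG integral_mult_right_zero integral_exp_decay(2)[OF Re_pos[OF p]]
          fourier_mellin_weight(2)[OF \<theta>]
        unfolding kernel[OF p] by (simp only:)
    qed
  qed
  also have "\<dots> = complex_of_real (\<integral>\<xi>. mellin_weight \<theta> \<xi> * (cmod (mellin f \<xi>))\<^sup>2 \<partial>lborel)"
    by (rule mellin_weighted_norm(2)[symmetric, OF fourier_mellin_weight(1)[OF \<theta>] _ f_meas f_int])
      (simp add: mellin_weight_def)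
  finally show "(\<integral>\<rho>. (cmod (laplace \<theta> f \<rho>))\<^sup>2 \<partial>Rplus) =
      (\<integral>\<xi>. mellin_weight \<theta> \<xi> * (cmod (mellin f \<xi>))\<^sup>2 \<partial>lborel)"
    by (simp only: of_real_eq_iff)
qed

section \<open>Plancherel inequality for the Mellin transform\<close>

text \<open>With u = ln t - ln s the antiderivative is the Gudermannian-type function 2 arctan (exp
  (u / (2 \<epsilon>))), which climbs from 0 to pi. The value does not depend on \<epsilon>, so the
  damped Plancherel bound is uniform while the damping is removed.\<close>

lemma integral_sech_log:
  fixes \<epsilon> s :: real
  assumes \<epsilon>: "\<epsilon> > 0"
  shows "(\<integral>\<^sup>+t. ennreal (1 / (2 * \<epsilon> * cosh ((ln s - ln t) / (2 * \<epsilon>))) / t) \<partial>Rplus) = ennreal pi"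
proof -
  define F where "F t = 2 * arctan (exp ((ln t - ln s) / (2 * \<epsilon>)))" for t
  define h where "h t = 1 / (2 * \<epsilon> * cosh ((ln s - ln t) / (2 * \<epsilon>))) / t" for t
  have cosh_pos': "2 * \<epsilon> * cosh y > 0" for y :: real
    using \<epsilon> cosh_real_pos[of y] by simp
  have deriv: "DERIV F t :> h t" if "t > 0" for t
  proof -
    define y where "y = (ln t - ln s) / (2 * \<epsilon>)"
    have "DERIV F t :> 2 * (inverse (1 + (exp y)\<^sup>2) * (exp y * (1 / t / (2 * \<epsilon>))))"
      unfolding F_def y_def using that \<epsilon>
      by (auto intro!: derivative_eq_intros simp: field_simps)
    moreover have "h t = 1 / (2 * \<epsilon> * cosh y) / t"
      using cosh_minus[of y] by (simp add: h_def y_def minus_divide_left)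
    moreover have "1 / (2 * cosh y) = inverse (1 + (exp y)\<^sup>2) * exp y"
    proof -
      have "1 + (exp y)\<^sup>2 = exp y * (2 * cosh y)"
        by (simp add: cosh_def exp_minus field_simps power2_eq_square)
      then show ?thesis by (simp add: field_simps)
    qed
    moreover have "1 / (2 * \<epsilon> * cosh y) / t = 1 / (2 * cosh y) * (2 * (1 / t / (2 * \<epsilon>)))"
      using \<epsilon> that by (simp add: field_simps)
    ultimately show ?thesis by (simp only: mult_ac)
  qed
  have cont: "isCont h t" if "t > 0" for t
    unfolding h_def using that cosh_pos' \<epsilon> by (intro continuous_intros) auto
  have nonneg: "h t \<ge> 0" if "t > 0" for t
    unfolding h_def using that cosh_pos' by (simp add: less_imp_le)
  have l0: "(F \<longlongrightarrow> 2 * arctan 0) (at_right 0)"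
  proof -
    have "filterlim (\<lambda>t::real. (ln t - ln s) / (2 * \<epsilon>)) at_bot (at_right 0)"
      using \<epsilon> by real_asymp
    then have "((\<lambda>t. exp ((ln t - ln s) / (2 * \<epsilon>))) \<longlongrightarrow> 0) (at_right 0)"
      by (rule filterlim_compose[OF exp_at_bot])
    then show ?thesis unfolding F_def by (intro tendsto_intros)
  qed
  have l1: "(F \<longlongrightarrow> 2 * (pi / 2)) at_top"
  proof -
    have "filterlim (\<lambda>t::real. (ln t - ln s) / (2 * \<epsilon>)) at_top at_top"
      using \<epsilon> by real_asymp
    then have "filterlim (\<lambda>t. exp ((ln t - ln s) / (2 * \<epsilon>))) at_top at_top"
      by (rule filterlim_compose[OF exp_at_top])
    then show ?thesis unfolding F_def
      by (intro tendsto_intros filterlim_compose[OF tendsto_arctan_at_top])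
  qed
  have ftc: "set_integrable lborel (einterval 0 \<infinity>) h" "(LBINT t=0..\<infinity>. h t) = 2 * (pi / 2) - 2 * arctan 0"
    by (rule interval_integral_FTC_nonneg[where F = F];
        use l0 l1 deriv cont nonneg in \<open>auto simp: zero_ereal_def ereal_tendsto_simps\<close>)+
  have h_meas: "h \<in> borel_measurable borel" unfolding h_def cosh_def by measurable
  then have smeas: "set_borel_measurable borel {0<..} h" by (auto simp: set_borel_measurable_def)
  have int: "integrable Rplus h"
    using ftc(1) by (simp add: integrable_Rplus_iff smeas zero_ereal_def)
  have "(\<integral>t. h t \<partial>Rplus) = pi"
    using ftc(2) by (simp add: integral_Rplus smeas interval_lebesgue_integral_0_infty)
  then show ?thesis
    using nn_integral_eq_integral[OF int AE_I2] nonneg unfolding h_def[symmetric] by simp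
qed

text \<open>Schur's test for the kernel P (ln s - ln t) / sqrt (s t). With a nonnegative integral
  the double integral can be estimated before it is known to be finite.\<close>

lemma nn_integral_schur_log:
  fixes f :: "real \<Rightarrow> complex" and P :: "real \<Rightarrow> real"
  assumes f [measurable]: "f \<in> borel_measurable Rplus"
    and P [measurable]: "P \<in> borel_measurable borel" and P_pos: "\<And>u. P u \<ge> 0" and P_even: "\<And>u. P (- u) = P u"
    and C: "\<And>s. s > 0 \<Longrightarrow> (\<integral>\<^sup>+t. ennreal (P (ln s - ln t) / t) \<partial>Rplus) = C"
  shows "(\<integral>\<^sup>+p. ennreal (cmod (f (fst p)) * cmod (f (snd p)) * exp (- (ln (fst p) + ln (snd p)) / 2) *
      P (ln (fst p) - ln (snd p))) \<partial>(Rplus \<Otimes>\<^sub>M Rplus)) \<le> C * (\<integral>\<^sup>+t. ennreal ((cmod (f t))\<^sup>2) \<partial>Rplus)"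
proof -
  define A where "A s t = ennreal ((cmod (f s))\<^sup>2) * ennreal (P (ln s - ln t) / t)" for s t
  have A_meas [measurable]: "(\<lambda>p. A (fst p) (snd p)) \<in> borel_measurable (Rplus \<Otimes>\<^sub>M Rplus)"
    "(\<lambda>p. A (snd p) (fst p)) \<in> borel_measurable (Rplus \<Otimes>\<^sub>M Rplus)"
  proof -
    note measurable_ident_Rplus [measurable]
    show "(\<lambda>p. A (fst p) (snd p)) \<in> borel_measurable (Rplus \<Otimes>\<^sub>M Rplus)"
      "(\<lambda>p. A (snd p) (fst p)) \<in> borel_measurable (Rplus \<Otimes>\<^sub>M Rplus)"
      unfolding A_def by measurable
  qed
  have inner: "(\<integral>\<^sup>+t. A s t \<partial>Rplus) = ennreal ((cmod (f s))\<^sup>2) * C" if "s > 0" for s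
    unfolding A_def using C[OF that]
    by (subst nn_integral_cmult) (auto intro!: borel_measurable_RplusI)
  have 1: "(\<integral>\<^sup>+p. A (fst p) (snd p) \<partial>(Rplus \<Otimes>\<^sub>M Rplus)) = C * (\<integral>\<^sup>+t. ennreal ((cmod (f t))\<^sup>2) \<partial>Rplus)"
  proof -
    have "(\<integral>\<^sup>+p. A (fst p) (snd p) \<partial>(Rplus \<Otimes>\<^sub>M Rplus)) = (\<integral>\<^sup>+s. \<integral>\<^sup>+t. A s t \<partial>Rplus \<partial>Rplus)"
      using Rplus.nn_integral_fst[of "\<lambda>p. A (fst p) (snd p)" Rplus] A_meas by simp
    also have "\<dots> = (\<integral>\<^sup>+s. ennreal ((cmod (f s))\<^sup>2) * C \<partial>Rplus)"
      by (intro nn_integral_cong) (simp add: inner)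
    also have "\<dots> = C * (\<integral>\<^sup>+t. ennreal ((cmod (f t))\<^sup>2) \<partial>Rplus)"
      by (subst nn_integral_multc) (auto simp: mult.commute)
    finally show ?thesis .
  qed
  have 2: "(\<integral>\<^sup>+p. A (snd p) (fst p) \<partial>(Rplus \<Otimes>\<^sub>M Rplus)) = C * (\<integral>\<^sup>+t. ennreal ((cmod (f t))\<^sup>2) \<partial>Rplus)"
  proof -
    have "(\<integral>\<^sup>+p. A (snd p) (fst p) \<partial>(Rplus \<Otimes>\<^sub>M Rplus)) = (\<integral>\<^sup>+p. A (fst p) (snd p) \<partial>(Rplus \<Otimes>\<^sub>M Rplus))"
      by (subst Rplus_pair.distr_pair_swap, subst nn_integral_distr) (auto simp: case_prod_beta)
    then show ?thesis using 1 by simp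
  qed
  have "(\<integral>\<^sup>+p. ennreal (cmod (f (fst p)) * cmod (f (snd p)) * exp (- (ln (fst p) + ln (snd p)) / 2) *
      P (ln (fst p) - ln (snd p))) \<partial>(Rplus \<Otimes>\<^sub>M Rplus)) \<le>
    (\<integral>\<^sup>+p. ennreal (1 / 2) * (A (fst p) (snd p) + A (snd p) (fst p)) \<partial>(Rplus \<Otimes>\<^sub>M Rplus))"
  proof (rule nn_integral_mono)
    fix p assume "p \<in> space (Rplus \<Otimes>\<^sub>M Rplus)"
    then obtain s t where p: "p = (s, t)" "s > 0" "t > 0" by (auto simp: space_pair_measure)
    define x y where "x = cmod (f s)" and "y = cmod (f t)"
    define Q where "Q = P (ln s - ln t)"
    have Q: "P (ln t - ln s) = Q" "Q \<ge> 0" using P_even[of "ln s - ln t"] P_pos by (auto simp: Q_def)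
    have "exp (- (ln s + ln t) / 2) = exp (- (ln s / 2)) * exp (- (ln t / 2))"
      by (simp add: mult_exp_exp add_divide_distrib)
    also have "\<dots> = 1 / (sqrt s * sqrt t)"
      using p by (simp add: exp_minus ln_sqrt[symmetric] inverse_eq_divide)
    finally have e: "exp (- (ln s + ln t) / 2) = 1 / (sqrt s * sqrt t)" .
    \<comment> \<open>AM--GM with crossed weights: the square of f at s is paired with 1 / t, so
      that the free variable t is integrated against P (ln s - ln t) / t, which gives C.\<close>
    have "0 \<le> (x / sqrt t - y / sqrt s)\<^sup>2" by simp
    also have "\<dots> = x\<^sup>2 / t + y\<^sup>2 / s - 2 * (x * y * (1 / (sqrt s * sqrt t)))"
      using p by (simp add: power2_diff power_divide field_simps)
    finally have "x * y * (1 / (sqrt s * sqrt t)) \<le> 1 / 2 * (x\<^sup>2 / t + y\<^sup>2 / s)" by (simp add: mult_ac)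
    then have "x * y * (1 / (sqrt s * sqrt t)) * Q \<le> 1 / 2 * (x\<^sup>2 / t + y\<^sup>2 / s) * Q"
      using Q by (intro mult_right_mono)
    also have "\<dots> = 1 / 2 * (x\<^sup>2 * (Q / t) + y\<^sup>2 * (Q / s))"
      by (simp add: algebra_simps)
    finally have "x * y * (1 / (sqrt s * sqrt t)) * Q \<le> 1 / 2 * (x\<^sup>2 * (Q / t) + y\<^sup>2 * (Q / s))" .
    then have "ennreal (x * y * (1 / (sqrt s * sqrt t)) * Q) \<le> ennreal (1 / 2 * (x\<^sup>2 * (Q / t) + y\<^sup>2 * (Q / s)))"
      by (rule ennreal_leI)
    also have "\<dots> = ennreal (1 / 2) * (ennreal (x\<^sup>2) * ennreal (Q / t) + ennreal (y\<^sup>2) * ennreal (Q / s))"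
    proof -
      have "0 \<le> x\<^sup>2 * (Q / t)" "0 \<le> y\<^sup>2 * (Q / s)" using p Q by auto
      then show ?thesis
        using p Q by (subst ennreal_mult) (simp_all only: ennreal_mult ennreal_plus add_nonneg_nonneg
          zero_le_power2 zero_le_divide_iff order.strict_implies_order simp_thms zero_le_one zero_le_numeral)
    qed
    finally show "ennreal (cmod (f (fst p)) * cmod (f (snd p)) * exp (- (ln (fst p) + ln (snd p)) / 2) *
      P (ln (fst p) - ln (snd p))) \<le> ennreal (1 / 2) * (A (fst p) (snd p) + A (snd p) (fst p))"
      unfolding p fst_conv snd_conv A_def e x_def[symmetric] y_def[symmetric] Q(1) Q_def[symmetric] .
  qed
  also have "\<dots> = ennreal (1 / 2) * (2 * (C * (\<integral>\<^sup>+t. ennreal ((cmod (f t))\<^sup>2) \<partial>Rplus)))"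
    by (subst nn_integral_cmult, simp, subst nn_integral_add) (simp_all only: 1 2 A_meas mult_2)
  also have "\<dots> = C * (\<integral>\<^sup>+t. ennreal ((cmod (f t))\<^sup>2) \<partial>Rplus)"
  proof -
    have "ennreal (1 / 2) * 2 = 1"
      by (subst ennreal_numeral[symmetric], subst ennreal_mult[symmetric]) auto
    then show ?thesis by (simp flip: mult.assoc)
  qed
  finally show ?thesis .
qed

text \<open>If g is not integrable, its Bochner integral is 0.\<close>

lemma integral_le_nn_integral:
  fixes g :: "'a \<Rightarrow> real"
  assumes "\<And>x. g x \<ge> 0"
  shows "ennreal (\<integral>x. g x \<partial>M) \<le> (\<integral>\<^sup>+x. ennreal (g x) \<partial>M)"
  using assms nn_integral_eq_integral[of M g]
  by (cases "integrable M g") (auto simp: not_integrable_integral_eq)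

text \<open>
  The dilated secant serves as the summability factor: its Fourier transform is known and positive, so
  Schur's test applies to the damped form.
\<close>

lemma mellin_damped_le:
  assumes \<epsilon>: "\<epsilon> > 0" and f: "f \<in> L2"
    and f_int: "integrable Rplus (\<lambda>t. cmod (f t) * exp (- ln t / 2))"
  shows "integrable lborel (\<lambda>\<xi>. mellin_weight 0 (\<epsilon> * \<xi>) * (cmod (mellin f \<xi>))\<^sup>2)"
    and "(\<integral>\<xi>. mellin_weight 0 (\<epsilon> * \<xi>) * (cmod (mellin f \<xi>))\<^sup>2 \<partial>lborel)
      \<le> pi * (\<integral>t. (cmod (f t))\<^sup>2 \<partial>Rplus)"
proof -
  have f_meas [measurable]: "f \<in> borel_measurable Rplus" and f2: "integrable Rplus (\<lambda>t. (cmod (f t))\<^sup>2)"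
    using f by (auto simp: L2_def)
  define w where "w \<xi> = mellin_weight 0 (\<epsilon> * \<xi>)" for \<xi>
  \<comment> \<open>The Fourier transform of \<open>w\<close>, proved as \<open>w_ft\<close>:
    dilating by \<epsilon> on the \<xi>-side dilates by 1 / \<epsilon> and divides by \<epsilon>
    here.\<close>
  define P where "P u = 1 / (2 * \<epsilon> * cosh (u / (2 * \<epsilon>)))" for u
  have w_pos: "w \<xi> \<ge> 0" for \<xi> by (simp add: w_def mellin_weight_def)
  have w_int: "integrable lborel w"
    using lborel_integrable_real_affine[OF fourier_mellin_weight(1)[of 0], of \<epsilon> 0] \<epsilon> unfolding w_def by simp
  have w_ft: "(\<integral>\<xi>. w \<xi> * exp (- (\<i> * of_real (\<xi> * u))) \<partial>lborel) = of_real (P u)" for u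
  proof -
    have "1 / (2 * cos (of_real 0 - \<i> * of_real (u / \<epsilon>) / 2)) =
       (\<integral>\<xi>. mellin_weight 0 \<xi> * exp (- (\<i> * of_real (\<xi> * (u / \<epsilon>)))) \<partial>lborel)"
      by (subst fourier_mellin_weight) auto
    also have "\<dots> = of_real \<epsilon> * (\<integral>\<xi>. w \<xi> * exp (- (\<i> * of_real (\<xi> * u))) \<partial>lborel)"
      using \<epsilon> by (subst lborel_integral_real_affine[where c = \<epsilon> and t = 0])
        (auto simp: scaleR_conv_of_real w_def mult.commute)
    finally have that: "1 / (2 * cos (of_real 0 - \<i> * of_real (u / \<epsilon>) / 2)) =
        of_real \<epsilon> * (\<integral>\<xi>. w \<xi> * exp (- (\<i> * of_real (\<xi> * u))) \<partial>lborel)" .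
    have "(\<integral>\<xi>. w \<xi> * exp (- (\<i> * of_real (\<xi> * u))) \<partial>lborel) =
        1 / (2 * of_real \<epsilon> * cos (of_real 0 - \<i> * of_real (u / \<epsilon>) / 2))"
    proof -
      \<comment> \<open>Again x / 0 = 0 covers c = 0.\<close>
      have "X = 1 / (2 * of_real \<epsilon> * c)" if "1 / (2 * c) = of_real \<epsilon> * X" for X c :: complex
        using \<epsilon> that by (cases "c = 0") (auto simp: field_simps)
      then show ?thesis using that .
    qed
    moreover have "cos (of_real 0 - \<i> * of_real (u / \<epsilon>) / 2) = of_real (cosh (u / (2 * \<epsilon>)))"
    proof -
      have "cos (of_real 0 - \<i> * of_real (u / \<epsilon>) / 2) = cosh (complex_of_real (u / (2 * \<epsilon>)))"
        by (simp add: cosh_conv_cos mult_ac)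
      also have "\<dots> = of_real (cosh (u / (2 * \<epsilon>)))"
        by (simp add: cosh_def scaleR_conv_of_real flip: exp_of_real)
      finally show ?thesis .
    qed
    ultimately show ?thesis by (simp add: P_def)
  qed
  have P_pos: "P u \<ge> 0" for u using \<epsilon> by (simp add: P_def)
  have P_meas [measurable]: "P \<in> borel_measurable borel" unfolding P_def cosh_def by measurable
  note ids = mellin_weighted_norm[OF w_int w_pos f_meas f_int]
  show "integrable lborel (\<lambda>\<xi>. mellin_weight 0 (\<epsilon> * \<xi>) * (cmod (mellin f \<xi>))\<^sup>2)"
    using ids(1) by (simp add: w_def)
  define I where "I = (\<integral>\<xi>. w \<xi> * (cmod (mellin f \<xi>))\<^sup>2 \<partial>lborel)"
  have I_pos: "I \<ge> 0" unfolding I_def using w_pos by simp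
  have "I = cmod (complex_of_real I)" using I_pos by simp
  also have "\<dots> \<le> (\<integral>p. cmod (f (fst p)) * cmod (f (snd p)) * exp (- (ln (fst p) + ln (snd p)) / 2) *
      P (ln (fst p) - ln (snd p)) \<partial>(Rplus \<Otimes>\<^sub>M Rplus))"
    unfolding I_def ids(2) w_ft
    by (rule order_trans[OF integral_norm_bound]) (simp add: norm_mult P_pos)
  finally have "ennreal I \<le> \<dots>" by (rule ennreal_leI)
  also have "\<dots> \<le> (\<integral>\<^sup>+p. ennreal (cmod (f (fst p)) * cmod (f (snd p)) * exp (- (ln (fst p) + ln (snd p)) / 2) *
      P (ln (fst p) - ln (snd p))) \<partial>(Rplus \<Otimes>\<^sub>M Rplus))"
    using P_pos by (intro integral_le_nn_integral) auto
  also have "\<dots> \<le> ennreal pi * (\<integral>\<^sup>+t. ennreal ((cmod (f t))\<^sup>2) \<partial>Rplus)"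
  proof (rule nn_integral_schur_log[OF f_meas P_meas P_pos])
    show "P (- u) = P u" for u by (simp add: P_def)
    show "(\<integral>\<^sup>+t. ennreal (P (ln s - ln t) / t) \<partial>Rplus) = ennreal pi" for s
      using integral_sech_log[OF \<epsilon>] by (simp only: P_def)
  qed
  also have "\<dots> = ennreal (pi * (\<integral>t. (cmod (f t))\<^sup>2 \<partial>Rplus))"
    using nn_integral_eq_integral[OF f2] by (simp add: ennreal_mult)
  finally show "(\<integral>\<xi>. mellin_weight 0 (\<epsilon> * \<xi>) * (cmod (mellin f \<xi>))\<^sup>2 \<partial>lborel)
      \<le> pi * (\<integral>t. (cmod (f t))\<^sup>2 \<partial>Rplus)"
    by (simp add: I_def w_def)
qed

text \<open>Since w is integrable, w times the squared transform is integrable and dominates its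
  damped versions. The damping factors tend to 1, so the damped inequality passes to the
  limit.\<close>

lemma mellin_weighted_le:
  fixes w :: "real \<Rightarrow> real"
  assumes w: "integrable lborel w" "\<And>\<xi>. w \<xi> \<ge> 0" "\<And>\<xi>. w \<xi> \<le> m" and f: "f \<in> L2"
    and f_int: "integrable Rplus (\<lambda>t. cmod (f t) * exp (- ln t / 2))"
  shows "(\<integral>\<xi>. w \<xi> * (cmod (mellin f \<xi>))\<^sup>2 \<partial>lborel) \<le> 2 * pi * m * (\<integral>t. (cmod (f t))\<^sup>2 \<partial>Rplus)"
proof -
  have f_meas: "f \<in> borel_measurable Rplus" using f by (auto simp: L2_def)
  \<comment> \<open>The secant weight is 1 / 2 at the origin. The factor 2 normalises it to 1 there
    and turns the constant pi of \<open>mellin_damped_le\<close> into 2 pi.\<close>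
  define d where "d n \<xi> = 2 * mellin_weight 0 (1 / Suc n * \<xi>)" for n \<xi>
  define g where "g \<xi> = w \<xi> * (cmod (mellin f \<xi>))\<^sup>2" for \<xi>
  have g_int: "integrable lborel g"
    unfolding g_def by (rule mellin_weighted_norm(1)[OF w(1,2) f_meas f_int])
  have m: "m \<ge> 0" using w(2,3) order_trans by blast
  have d_meas [measurable]: "d n \<in> borel_measurable borel" for n
    unfolding d_def mellin_weight_def cosh_def by measurable
  have d: "0 \<le> d n \<xi>" "d n \<xi> \<le> 1" for n \<xi>
    using cosh_real_ge_1[of "pi * (\<xi> / Suc n)"] by (auto simp: d_def mellin_weight_def field_simps)
  have d_lim: "(\<lambda>n. d n \<xi>) \<longlonglongrightarrow> 1" for \<xi>
  proof -
    have "(\<lambda>n. cosh (pi * (1 / Suc n * \<xi>))) \<longlonglongrightarrow> cosh (pi * (0 * \<xi>))"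
      by (intro tendsto_intros LIMSEQ_Suc[OF lim_1_over_n])
    then have "(\<lambda>n. 1 / cosh (pi * (1 / Suc n * \<xi>))) \<longlonglongrightarrow> 1 / cosh (pi * (0 * \<xi>))"
      by (rule tendsto_divide[OF tendsto_const]) simp
    then show ?thesis by (simp add: d_def mellin_weight_def)
  qed
  have le: "(\<integral>\<xi>. d n \<xi> * g \<xi> \<partial>lborel) \<le> 2 * pi * m * (\<integral>t. (cmod (f t))\<^sup>2 \<partial>Rplus)" for n
  proof -
    note damped = mellin_damped_le[OF _ f f_int, of "1 / Suc n"]
    have "(\<integral>\<xi>. d n \<xi> * g \<xi> \<partial>lborel) \<le>
      (\<integral>\<xi>. 2 * m * (mellin_weight 0 (1 / Suc n * \<xi>) * (cmod (mellin f \<xi>))\<^sup>2) \<partial>lborel)"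
    proof (rule integral_mono)
      show "integrable lborel (\<lambda>\<xi>. d n \<xi> * g \<xi>)"
      proof (rule Bochner_Integration.integrable_bound[OF g_int])
        show "AE \<xi> in lborel. norm (d n \<xi> * g \<xi>) \<le> norm (g \<xi>)"
          using d by (auto simp: abs_mult intro!: mult_left_le_one_le)
      qed (use g_int in measurable)
      show "d n \<xi> * g \<xi> \<le> 2 * m * (mellin_weight 0 (1 / Suc n * \<xi>) * (cmod (mellin f \<xi>))\<^sup>2)" for \<xi>
      proof -
        have "w \<xi> * (d n \<xi> * (cmod (mellin f \<xi>))\<^sup>2) \<le> m * (d n \<xi> * (cmod (mellin f \<xi>))\<^sup>2)"
          using d w(3) by (intro mult_right_mono) auto
        then show ?thesis by (simp add: d_def g_def mult_ac)
      qed
    qed (use damped(1) in auto)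
    also have "\<dots> = 2 * m * (\<integral>\<xi>. mellin_weight 0 (1 / Suc n * \<xi>) * (cmod (mellin f \<xi>))\<^sup>2 \<partial>lborel)"
      by (rule integral_mult_right_zero)
    also have "\<dots> \<le> 2 * m * (pi * (\<integral>t. (cmod (f t))\<^sup>2 \<partial>Rplus))"
      using m damped(2) by (intro mult_left_mono) auto
    finally show ?thesis by (simp add: mult_ac)
  qed
  have "(\<lambda>n. \<integral>\<xi>. d n \<xi> * g \<xi> \<partial>lborel) \<longlonglongrightarrow> (\<integral>\<xi>. g \<xi> \<partial>lborel)"
  proof (rule integral_dominated_convergence[where w = "\<lambda>\<xi>. norm (g \<xi>)"])
    show "AE \<xi> in lborel. (\<lambda>n. d n \<xi> * g \<xi>) \<longlonglongrightarrow> g \<xi>"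
      using tendsto_mult[OF d_lim tendsto_const] by (intro AE_I2) fastforce
    show "AE \<xi> in lborel. norm (d n \<xi> * g \<xi>) \<le> norm (g \<xi>)" for n
      using d by (auto simp: abs_mult intro!: mult_left_le_one_le)
    show "integrable lborel (\<lambda>\<xi>. norm (g \<xi>))" using g_int by simp
  qed (use g_int in measurable)
  then show ?thesis
    unfolding g_def[symmetric] by (rule LIMSEQ_le_const2) (use le in auto)
qed

section \<open>The sharp constant\<close>

text \<open>Half of this is the Legendre transform of ln cosh, the supremum over x of m x - ln (cosh
  x); in terms of the binary entropy H with natural logarithms it is ln 2 - H((1 + m) / 2).\<close>

definition entropy_sum :: "real \<Rightarrow> real" where
  "entropy_sum m = (1 - m) * ln (1 - m) + (1 + m) * ln (1 + m)"

text \<open>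
  The exponential form gives the right value at \<open>\<bar>\<theta>\<bar> = pi / 2\<close>, where \<open>0 * ln 0 = 0\<close>; the form with
  \<open>powr\<close> does not, because \<open>0 powr 0 = 0\<close>.
\<close>

definition sharp_const :: "real \<Rightarrow> real" where
  "sharp_const \<theta> = sqrt pi * exp (entropy_sum (\<bar>\<theta>\<bar> / (pi / 2)) / 4)"

lemma sharp_const_pos: "sharp_const \<theta> > 0"
  by (simp add: sharp_const_def)

lemma sharp_const_sq: "(sharp_const \<theta>)\<^sup>2 = pi * exp (entropy_sum (\<theta> / (pi / 2)) / 2)"
proof -
  have "entropy_sum (- m) = entropy_sum m" for m by (simp add: entropy_sum_def)
  then have "entropy_sum (\<bar>\<theta>\<bar> / (pi / 2)) = entropy_sum (\<theta> / (pi / 2))"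
    by (cases "\<theta> \<ge> 0") (metis abs_of_nonneg, metis abs_of_neg linorder_not_le minus_divide_left)
  then show ?thesis
    by (simp add: sharp_const_def power_mult_distrib flip: exp_of_nat_mult)
qed

lemma sharp_const_powr:
  assumes "\<bar>\<theta>\<bar> < pi / 2" and \<mu>: "\<mu> = \<bar>\<theta>\<bar> / (pi / 2)"
  shows "sharp_const \<theta> = sqrt pi * (1 - \<mu>) powr ((1 - \<mu>) / 4) * (1 + \<mu>) powr ((1 + \<mu>) / 4)"
proof -
  have "0 \<le> \<mu>" by (simp add: \<mu>)
  moreover have "\<mu> < 1" unfolding \<mu> using assms(1) by (subst pos_divide_less_eq) auto
  ultimately show ?thesis
    unfolding sharp_const_def \<mu>[symmetric]
    by (simp add: entropy_sum_def powr_def mult_exp_exp add_divide_distrib mult.assoc)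
qed

lemma sharp_const_half_pi:
  assumes "\<bar>\<theta>\<bar> = pi / 2"
  shows "sharp_const \<theta> = sqrt (2 * pi)"
proof -
  have "exp (ln 2 / 2) = sqrt (2 :: real)" by (simp add: ln_sqrt[symmetric])
  then show ?thesis using assms
    by (simp add: sharp_const_def entropy_sum_def real_sqrt_mult)
qed

text \<open>At the endpoints this rests on x ln x tending to 0, the value of \<open>x * ln x\<close>
  at x = 0. It is what lets the bound pass from interior angles to the boundary.\<close>

lemma continuous_on_entropy_sum: "continuous_on {-1..1} entropy_sum"
proof -
  have lim: "((\<lambda>x::real. x * ln x) \<longlongrightarrow> 0 * ln 0) (at_right 0)"
    by (simp, real_asymp)
  have "continuous_on {0..} (\<lambda>x::real. x * ln x)"
    unfolding continuous_on_def
  proof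
    fix x :: real assume "x \<in> {0..}"
    then consider "x = 0" | "x > 0" by fastforce
    then show "((\<lambda>x. x * ln x) \<longlongrightarrow> x * ln x) (at x within {0..})"
    proof cases
      case 1
      then show ?thesis using lim by (simp add: at_within_Ici_at_right)
    next
      case 2
      then have "isCont (\<lambda>x. x * ln x) x" by (intro continuous_intros) auto
      then have "continuous (at x within {0..}) (\<lambda>x. x * ln x)"
        by (rule continuous_at_imp_continuous_within)
      then show ?thesis by (simp add: continuous_within)
    qed
  qed
  note c = continuous_on_compose2[OF this]
  show ?thesis unfolding entropy_sum_def
    by (intro continuous_on_add c[of _ "\<lambda>m. 1 - m"] c[of _ "\<lambda>m. 1 + m"] continuous_intros) auto
qed

lemma strict_mono_on_entropy_sum: "strict_mono_on {0..1} entropy_sum"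
proof (rule strict_mono_onI)
  fix a b :: real assume ab: "a \<in> {0..1}" "b \<in> {0..1}" "a < b"
  show "entropy_sum a < entropy_sum b"
  \<comment> \<open>The derivative ln (1 + x) - ln (1 - x) vanishes at 0 and blows up at 1, so
    positivity is available on the open interval only.\<close>
  proof (rule DERIV_pos_imp_increasing_open[OF ab(3)])
    show "continuous_on {a..b} entropy_sum"
      by (rule continuous_on_subset[OF continuous_on_entropy_sum]) (use ab in auto)
    fix x assume x: "a < x" "x < b"
    with ab have x': "0 < x" "x < 1" by auto
    have "DERIV entropy_sum x :> ln (1 + x) - ln (1 - x)"
      unfolding entropy_sum_def using x'
      by (auto intro!: derivative_eq_intros)
    then show "\<exists>y. DERIV entropy_sum x :> y \<and> y > 0"
      using x' by (intro exI[of _ "ln (1 + x) - ln (1 - x)"]) auto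
  qed
qed

lemma strict_mono_on_sharp_const: "strict_mono_on {0..pi/2} sharp_const"
proof (rule strict_mono_onI)
  fix a b assume ab: "a \<in> {0..pi/2}" "b \<in> {0..pi/2}" "a < b"
  then have "entropy_sum (\<bar>a\<bar> / (pi / 2)) < entropy_sum (\<bar>b\<bar> / (pi / 2))"
    by (intro strict_mono_onD[OF strict_mono_on_entropy_sum]) (auto simp: field_simps)
  then show "sharp_const a < sharp_const b" by (simp add: sharp_const_def)
qed

lemma continuous_on_sharp_const: "continuous_on {-pi/2..pi/2} sharp_const"
proof -
  have "continuous_on {-pi/2..pi/2} (\<lambda>\<theta>. entropy_sum (\<bar>\<theta>\<bar> / (pi / 2)))"
  proof (rule continuous_on_compose2[OF continuous_on_entropy_sum])
    have "\<bar>\<theta>\<bar> / (pi / 2) \<in> {-1..1}" if "\<theta> \<in> {-pi/2..pi/2}" for \<theta>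
    proof -
      have "\<bar>\<theta>\<bar> / (pi / 2) \<le> 1" using that by (subst pos_divide_le_eq) auto
      moreover have "\<bar>\<theta>\<bar> / (pi / 2) \<ge> 0" by simp
      ultimately show ?thesis using order_trans[of "-1" 0 "\<bar>\<theta>\<bar> / (pi / 2)"] by simp
    qed
    then show "(\<lambda>\<theta>. \<bar>\<theta>\<bar> / (pi / 2)) ` {-pi/2..pi/2} \<subseteq> {-1..1}" by blast
  qed (intro continuous_intros, simp)
  then show ?thesis unfolding sharp_const_def by (intro continuous_intros) auto
qed

lemma sharp_const_le:
  assumes "\<theta> \<in> {-pi/2..pi/2}"
  shows "sharp_const \<theta> \<le> sqrt (2 * pi)"
proof -
  have "sharp_const \<bar>\<theta>\<bar> \<le> sharp_const (pi / 2)"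
    using assms by (intro strict_mono_on_leD[OF strict_mono_on_sharp_const]) auto
  moreover have "sharp_const \<bar>\<theta>\<bar> = sharp_const \<theta>" by (simp add: sharp_const_def)
  ultimately show ?thesis using sharp_const_half_pi[of "pi / 2"] by simp
qed

text \<open>Weighted AM--GM applied to the two exponentials in \<open>cosh\<close>.\<close>

lemma exp_le_entropy_cosh:
  fixes m x :: real
  assumes m: "\<bar>m\<bar> < 1"
  shows "exp (m * x) \<le> exp (entropy_sum m / 2) * cosh x"
    and "x = (ln (1 + m) - ln (1 - m)) / 2 \<Longrightarrow> exp (m * x) = exp (entropy_sum m / 2) * cosh x"
proof -
  \<comment> \<open>With weights p and 1 - p, cosh x is the mean of exp A and exp B; the logarithmic
    shifts make the mean exponent equal to m x - \<open>entropy_sum m\<close> / 2. Equality in the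
    convexity bound occurs at A = B, that is x = artanh m.\<close>
  define A B p where "A = x - ln (1 + m)" and "B = - x - ln (1 - m)" and "p = (1 + m) / 2"
  have m': "1 + m > 0" "1 - m > 0" using m by auto
  have cosh: "cosh x = (1 - p) * exp B + p * exp A"
  proof -
    have "exp A = exp x / (1 + m)" "exp B = exp (- x) / (1 - m)" "1 - p = (1 - m) / 2"
      using m' by (auto simp: A_def B_def p_def exp_diff field_simps)
    then show ?thesis using m' by (simp add: cosh_def p_def field_simps)
  qed
  have exps: "m * x = entropy_sum m / 2 + ((1 - p) * B + p * A)"
    by (simp add: A_def B_def p_def entropy_sum_def field_simps)
  have "exp ((1 - p) *\<^sub>R B + p *\<^sub>R A) \<le> (1 - p) * exp B + p * exp A"
    using m' by (intro convex_onD[OF exp_convex]) (auto simp: p_def)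
  then show "exp (m * x) \<le> exp (entropy_sum m / 2) * cosh x"
    unfolding exps exp_add cosh by simp
  assume "x = (ln (1 + m) - ln (1 - m)) / 2"
  then have "A = B" by (simp add: A_def B_def field_simps)
  then have "(1 - p) * B + p * A = B" "cosh x = exp B"
    unfolding cosh by (simp_all add: algebra_simps)
  then show "exp (m * x) = exp (entropy_sum m / 2) * cosh x"
    by (simp only: exps exp_add)
qed

text \<open>This is the cosh inequality with m = 2 \<theta> / pi and x = pi \<xi>. At interior
  angles the maximiser artanh m is finite, so the supremum is attained.\<close>

lemma mellin_weight_le:
  assumes "\<bar>\<theta>\<bar> < pi / 2"
  shows "2 * pi * mellin_weight \<theta> \<xi> \<le> (sharp_const \<theta>)\<^sup>2"
    and "\<exists>\<xi>. 2 * pi * mellin_weight \<theta> \<xi> = (sharp_const \<theta>)\<^sup>2"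
proof -
  define m where "m = \<theta> / (pi / 2)"
  have m: "\<bar>m\<bar> < 1" using assms by (simp add: m_def field_simps)
  have eq: "2 * pi * mellin_weight \<theta> \<xi> = pi * (exp (m * (pi * \<xi>)) / cosh (pi * \<xi>))" for \<xi>
    by (simp add: mellin_weight_def m_def mult_ac)
  show "2 * pi * mellin_weight \<theta> \<xi> \<le> (sharp_const \<theta>)\<^sup>2"
    using exp_le_entropy_cosh(1)[OF m, of "pi * \<xi>"]
    unfolding eq sharp_const_sq m_def[symmetric]
    by (simp add: divide_le_eq cosh_real_pos)
  define \<xi> where "\<xi> = (ln (1 + m) - ln (1 - m)) / 2 / pi"
  have "2 * pi * mellin_weight \<theta> \<xi> = (sharp_const \<theta>)\<^sup>2"
    using exp_le_entropy_cosh(2)[OF m, of "pi * \<xi>"]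
    unfolding eq sharp_const_sq m_def[symmetric] by (simp add: \<xi>_def)
  then show "\<exists>\<xi>. 2 * pi * mellin_weight \<theta> \<xi> = (sharp_const \<theta>)\<^sup>2" by blast
qed

section \<open>Norm and limits in L2\<close>

lemma nn_integral_L2_norm:
  assumes "f \<in> L2"
  shows "(\<integral>\<^sup>+x. ennreal ((cmod (f x))\<^sup>2) \<partial>Rplus) = ennreal ((L2_norm f)\<^sup>2)"
  using assms by (subst nn_integral_eq_integral) (auto simp: L2_def L2_norm_def)

lemma L2_norm_nonneg [simp]: "L2_norm f \<ge> 0"
  by (simp add: L2_norm_def)

lemma L2I:
  assumes "f \<in> borel_measurable Rplus" "c \<ge> 0"
    and le: "(\<integral>\<^sup>+x. ennreal ((cmod (f x))\<^sup>2) \<partial>Rplus) \<le> ennreal (c\<^sup>2)"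
  shows "f \<in> L2" "L2_norm f \<le> c"
proof -
  have "integrable Rplus (\<lambda>x. (cmod (f x))\<^sup>2)"
    using assms(1) le by (intro integrableI_bounded) (auto intro: le_less_trans)
  then show L2: "f \<in> L2" using assms(1) by (simp add: L2_def)
  show "L2_norm f \<le> c"
    using le assms(2) unfolding nn_integral_L2_norm[OF L2] by (simp add: power2_le_iff_abs_le)
qed

lemma L2_norm_AE_cong:
  assumes "f \<in> L2" "g \<in> borel_measurable Rplus" "AE x in Rplus. g x = f x"
  shows "g \<in> L2" "L2_norm g = L2_norm f"
proof -
  have [measurable]: "f \<in> borel_measurable Rplus" "g \<in> borel_measurable Rplus"
    using assms by (auto simp: L2_def)
  have ae: "AE x in Rplus. (cmod (g x))\<^sup>2 = (cmod (f x))\<^sup>2" using assms(3) by eventually_elim simp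
  have "integrable Rplus (\<lambda>x. (cmod (g x))\<^sup>2) \<longleftrightarrow> integrable Rplus (\<lambda>x. (cmod (f x))\<^sup>2)"
    by (rule integrable_cong_AE[OF _ _ ae]) measurable
  then show "g \<in> L2" using assms(1,2) by (simp add: L2_def)
  have "(\<integral>x. (cmod (g x))\<^sup>2 \<partial>Rplus) = (\<integral>x. (cmod (f x))\<^sup>2 \<partial>Rplus)"
    by (rule integral_cong_AE[OF _ _ ae]) measurable
  then show "L2_norm g = L2_norm f" by (simp add: L2_norm_def)
qed

text \<open>Square-integrability of the limit is part of the conclusion. The bounds
  \<open>C n\<close> vary with n because the sharp constant does when the angle moves.\<close>

lemma L2_fatou:
  assumes g: "\<And>n. g n \<in> L2" and le: "\<And>n. L2_norm (g n) \<le> C n" and C: "C \<longlonglongrightarrow> c"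
    and f: "f \<in> borel_measurable Rplus" and lim: "AE x in Rplus. (\<lambda>n. g n x) \<longlonglongrightarrow> f x"
  shows "f \<in> L2" "L2_norm f \<le> c"
proof -
  have [measurable]: "g n \<in> borel_measurable Rplus" for n using g by (simp add: L2_def)
  have C_pos: "C n \<ge> 0" for n using le[of n] L2_norm_nonneg[of "g n"] by linarith
  have c: "c \<ge> 0" by (rule LIMSEQ_le_const[OF C]) (use C_pos in auto)
  have "(\<integral>\<^sup>+x. ennreal ((cmod (f x))\<^sup>2) \<partial>Rplus) =
      (\<integral>\<^sup>+x. liminf (\<lambda>n. ennreal ((cmod (g n x))\<^sup>2)) \<partial>Rplus)"
  proof (rule nn_integral_cong_AE)
    show "AE x in Rplus. ennreal ((cmod (f x))\<^sup>2) = liminf (\<lambda>n. ennreal ((cmod (g n x))\<^sup>2))"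
      using lim
    proof eventually_elim
      case (elim x)
      then have "(\<lambda>n. ennreal ((cmod (g n x))\<^sup>2)) \<longlonglongrightarrow> ennreal ((cmod (f x))\<^sup>2)"
        by (intro tendsto_intros)
      then show ?case by (intro lim_imp_Liminf[symmetric]) auto
    qed
  qed
  also have "\<dots> \<le> liminf (\<lambda>n. \<integral>\<^sup>+x. ennreal ((cmod (g n x))\<^sup>2) \<partial>Rplus)"
    by (rule nn_integral_liminf) measurable
  also have "\<dots> \<le> liminf (\<lambda>n. ennreal ((C n)\<^sup>2))"
  proof (rule Liminf_mono, rule always_eventually, rule allI)
    show "(\<integral>\<^sup>+x. ennreal ((cmod (g n x))\<^sup>2) \<partial>Rplus) \<le> ennreal ((C n)\<^sup>2)" for n
      unfolding nn_integral_L2_norm[OF g] using le by (intro ennreal_leI power_mono) auto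
  qed
  also have "\<dots> = ennreal (c\<^sup>2)"
    by (intro lim_imp_Liminf tendsto_intros C) auto
  finally show "f \<in> L2" "L2_norm f \<le> c" using L2I[OF f c] by auto
qed

section \<open>The upper bound at every angle\<close>

lemma laplace_measurable:
  assumes "f \<in> borel_measurable Rplus"
  shows "laplace \<theta> f \<in> borel_measurable Rplus"
proof -
  note assms [measurable] measurable_ident_Rplus [measurable]
  have "(\<lambda>\<rho>. \<integral>t. f t * exp (- (complex_of_real (\<rho> * t) * exp (\<i> * complex_of_real \<theta>))) \<partial>Rplus)
    \<in> borel_measurable Rplus"
    by measurable
  then show ?thesis unfolding laplace_def [abs_def] .
qed

text \<open>Function and angle move simultaneously. As the cosine of the angle is nonnegative, the
  exponential has modulus at most 1, so the modulus of f is an integrable majorant even at boundary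
  angles.\<close>

lemma laplace_tendsto:
  assumes f: "integrable Rplus f" and fn: "\<And>n. fn n \<in> borel_measurable Rplus"
    and le: "\<And>n t. t > 0 \<Longrightarrow> cmod (fn n t) \<le> cmod (f t)"
    and lim: "\<And>t. t > 0 \<Longrightarrow> (\<lambda>n. fn n t) \<longlonglongrightarrow> f t"
    and \<theta>n: "\<And>n. \<theta>n n \<in> {-pi/2..pi/2}" "\<theta>n \<longlonglongrightarrow> \<theta>" and \<rho>: "\<rho> > 0"
  shows "(\<lambda>n. laplace (\<theta>n n) (fn n) \<rho>) \<longlonglongrightarrow> laplace \<theta> f \<rho>"
  unfolding laplace_def
proof (rule integral_dominated_convergence[where w = "\<lambda>t. cmod (f t)"])
  note fn [measurable] measurable_ident_Rplus [measurable]
  have [measurable]: "f \<in> borel_measurable Rplus" using f by auto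
  show "(\<lambda>t. f t * exp (- (complex_of_real (\<rho> * t) * exp (\<i> * complex_of_real \<theta>)))) \<in> borel_measurable Rplus"
    by measurable
  show "(\<lambda>t. fn n t * exp (- (complex_of_real (\<rho> * t) * exp (\<i> * complex_of_real (\<theta>n n))))) \<in> borel_measurable Rplus" for n
    by measurable
  show "integrable Rplus (\<lambda>t. cmod (f t))" using f by simp
  show "AE t in Rplus. (\<lambda>n. fn n t * exp (- (complex_of_real (\<rho> * t) * exp (\<i> * complex_of_real (\<theta>n n)))))
      \<longlonglongrightarrow> f t * exp (- (complex_of_real (\<rho> * t) * exp (\<i> * complex_of_real \<theta>)))"
    by (intro AE_I2 tendsto_intros lim \<theta>n) auto
  show "AE t in Rplus. norm (fn n t * exp (- (complex_of_real (\<rho> * t) * exp (\<i> * complex_of_real (\<theta>n n))))) \<le> cmod (f t)" for n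
  proof (rule AE_I2)
    fix t assume "t \<in> space Rplus"
    then have t: "t > 0" by simp
    have "cos (\<theta>n n) \<ge> 0" using \<theta>n(1)[of n] by (intro cos_ge_zero) auto
    then have "cmod (exp (- (complex_of_real (\<rho> * t) * exp (\<i> * complex_of_real (\<theta>n n))))) \<le> 1"
      using t \<rho> by (simp add: Re_exp)
    then show "norm (fn n t * exp (- (complex_of_real (\<rho> * t) * exp (\<i> * complex_of_real (\<theta>n n))))) \<le> cmod (f t)"
      unfolding norm_mult using le[OF t, of n] mult_mono[of "cmod (fn n t)" "cmod (f t)" _ 1] by simp
  qed
qed

lemma laplace_bound_interior:
  assumes \<theta>: "\<bar>\<theta>\<bar> < pi / 2" and f: "f \<in> L1 \<inter> L2"
    and f_int: "integrable Rplus (\<lambda>t. cmod (f t) * exp (- ln t / 2))"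
  shows "laplace \<theta> f \<in> L2" "L2_norm (laplace \<theta> f) \<le> sharp_const \<theta> * L2_norm f"
proof -
  have f1: "integrable Rplus f" and f2: "f \<in> L2" and f_meas: "f \<in> borel_measurable Rplus"
    using f by (auto simp: L1_def L2_def)
  note eq = laplace_norm_eq_mellin[OF \<theta> f1 f_int]
  show "laplace \<theta> f \<in> L2"
    using eq(1) laplace_measurable[OF f_meas] by (simp add: L2_def)
  have "(L2_norm (laplace \<theta> f))\<^sup>2 = (\<integral>\<xi>. mellin_weight \<theta> \<xi> * (cmod (mellin f \<xi>))\<^sup>2 \<partial>lborel)"
    by (simp add: L2_norm_def eq(2)[symmetric])
  also have "\<dots> \<le> 2 * pi * ((sharp_const \<theta>)\<^sup>2 / (2 * pi)) * (\<integral>t. (cmod (f t))\<^sup>2 \<partial>Rplus)"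
  proof (rule mellin_weighted_le[OF fourier_mellin_weight(1)[OF \<theta>] _ _ f2 f_int])
    show "mellin_weight \<theta> \<xi> \<le> (sharp_const \<theta>)\<^sup>2 / (2 * pi)" for \<xi>
      using mellin_weight_le(1)[OF \<theta>, of \<xi>] by (simp add: field_simps)
  qed (simp add: mellin_weight_def)
  also have "\<dots> = (sharp_const \<theta> * L2_norm f)\<^sup>2"
    by (simp add: L2_norm_def power_mult_distrib)
  finally show "L2_norm (laplace \<theta> f) \<le> sharp_const \<theta> * L2_norm f"
    by (rule power2_le_imp_le) (simp add: sharp_const_pos less_imp_le)
qed

lemma L2_norm_mono:
  assumes f: "f \<in> L2" and g: "g \<in> borel_measurable Rplus"
    and le: "\<And>x. x > 0 \<Longrightarrow> cmod (g x) \<le> cmod (f x)"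
  shows "g \<in> L2" "L2_norm g \<le> L2_norm f"
proof -
  have "(\<integral>\<^sup>+x. ennreal ((cmod (g x))\<^sup>2) \<partial>Rplus) \<le> ennreal ((L2_norm f)\<^sup>2)"
    unfolding nn_integral_L2_norm[OF f, symmetric]
    by (intro nn_integral_mono ennreal_leI power_mono) (auto intro: le)
  then show "g \<in> L2" "L2_norm g \<le> L2_norm f" using L2I[OF g, of "L2_norm f"] by auto
qed

text \<open>Cutting f off near 0 makes f(t) / sqrt t integrable (elsewhere f in L1 controls it), and
  shrinking the angle makes it interior. Both changes are undone by one application of
  \<open>L2_fatou\<close>; continuity of the sharp constant gives the limit of the bounds.\<close>

lemma laplace_bound_sharp_const:
  assumes \<theta>: "\<theta> \<in> {-pi/2..pi/2}"
  shows "laplace_bound \<theta> (sharp_const \<theta>)"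
  unfolding laplace_bound_def
proof
  fix f assume f: "f \<in> L1 \<inter> L2"
  have f1: "integrable Rplus f" and f2: "f \<in> L2" and f_meas [measurable]: "f \<in> borel_measurable Rplus"
    using f by (auto simp: L1_def L2_def)
  define fn where "fn n t = (if t \<ge> 1 / Suc n then f t else 0)" for n :: nat and t :: real
  \<comment> \<open>The factor is below 1, so even the two boundary angles are moved strictly
    inside.\<close>
  define \<theta>n where "\<theta>n n = \<theta> * (1 - 1 / Suc (Suc n))" for n :: nat
  have fn_meas: "fn n \<in> borel_measurable Rplus" for n
  proof -
    note measurable_ident_Rplus [measurable]
    show ?thesis unfolding fn_def by measurable
  qed
  have fn_le: "cmod (fn n t) \<le> cmod (f t)" for n t by (simp add: fn_def)
  have fn: "fn n \<in> L1 \<inter> L2" and fn_norm: "L2_norm (fn n) \<le> L2_norm f" for n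
    using L2_norm_mono[OF f2 fn_meas fn_le] Bochner_Integration.integrable_bound[OF f1 fn_meas AE_I2[OF fn_le]]
    by (auto simp: L1_def)
  have fn_int: "integrable Rplus (\<lambda>t. cmod (fn n t) * exp (- ln t / 2))" for n
  proof (rule Bochner_Integration.integrable_bound)
    \<comment> \<open>On t \<ge> 1 / (n + 1) one has 1 / sqrt t \<le> sqrt (n + 1), which is the
      constant factor here.\<close>
    show "integrable Rplus (\<lambda>t. cmod (f t) * exp (ln (Suc n) / 2))" using f1 by simp
    note fn_meas [measurable] measurable_ident_Rplus [measurable]
    show "(\<lambda>t. cmod (fn n t) * exp (- ln t / 2)) \<in> borel_measurable Rplus" by measurable
    show "AE t in Rplus. norm (cmod (fn n t) * exp (- ln t / 2)) \<le> norm (cmod (f t) * exp (ln (Suc n) / 2))"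
    proof (rule AE_I2)
      fix t assume "t \<in> space Rplus"
      then have t: "t > 0" by simp
      have "- ln t \<le> ln (Suc n)" if "1 / Suc n \<le> t"
        using that t ln_mono[of "1 / t" "Suc n"] by (simp add: ln_div field_simps)
      then show "norm (cmod (fn n t) * exp (- ln t / 2)) \<le> norm (cmod (f t) * exp (ln (Suc n) / 2))"
        by (auto simp: fn_def intro!: mult_left_mono)
    qed
  qed
  have \<theta>n: "\<bar>\<theta>n n\<bar> < pi / 2" "\<theta>n n \<in> {-pi/2..pi/2}" for n
  proof -
    have "\<bar>\<theta>n n\<bar> = \<bar>\<theta>\<bar> * (1 - 1 / Suc (Suc n))" by (simp add: \<theta>n_def abs_mult)
    also have "\<dots> \<le> pi / 2 * (1 - 1 / Suc (Suc n))"
      using \<theta> by (intro mult_right_mono) auto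
    also have "\<dots> < pi / 2 * 1" by (intro mult_strict_left_mono) auto
    finally show "\<bar>\<theta>n n\<bar> < pi / 2" by simp
    then show "\<theta>n n \<in> {-pi/2..pi/2}" by auto
  qed
  have \<theta>n_lim: "\<theta>n \<longlonglongrightarrow> \<theta>"
  proof -
    have "\<theta>n \<longlonglongrightarrow> \<theta> * (1 - 0)" unfolding \<theta>n_def
      by (intro tendsto_intros LIMSEQ_Suc[OF LIMSEQ_Suc[OF lim_1_over_n]])
    then show ?thesis by simp
  qed
  have fn_lim: "(\<lambda>n. fn n t) \<longlonglongrightarrow> f t" if "t > 0" for t
  proof (rule tendsto_eventually)
    have "(\<lambda>n. 1 / real (Suc n)) \<longlonglongrightarrow> 0" by (rule LIMSEQ_Suc[OF lim_1_over_n])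
    from order_tendstoD(2)[OF this that]
    show "\<forall>\<^sub>F n in sequentially. fn n t = f t"
      by eventually_elim (simp add: fn_def)
  qed
  have "(\<lambda>n. sharp_const (\<theta>n n)) \<longlonglongrightarrow> sharp_const \<theta>"
    by (rule continuous_on_tendsto_compose[OF continuous_on_sharp_const \<theta>n_lim \<theta>]) (use \<theta>n in auto)
  then have C: "(\<lambda>n. sharp_const (\<theta>n n) * L2_norm f) \<longlonglongrightarrow> sharp_const \<theta> * L2_norm f"
    by (intro tendsto_intros)
  have le: "L2_norm (laplace (\<theta>n n) (fn n)) \<le> sharp_const (\<theta>n n) * L2_norm f" for n
    using laplace_bound_interior(2)[OF \<theta>n(1) fn fn_int] fn_norm[of n] sharp_const_pos[of "\<theta>n n"]
    by (meson mult_left_mono less_imp_le order_trans)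
  have lim: "AE \<rho> in Rplus. (\<lambda>n. laplace (\<theta>n n) (fn n) \<rho>) \<longlonglongrightarrow> laplace \<theta> f \<rho>"
    by (intro AE_I2 laplace_tendsto[OF f1 fn_meas fn_le fn_lim \<theta>n(2) \<theta>n_lim]) auto
  show "laplace \<theta> f \<in> L2 \<and> L2_norm (laplace \<theta> f) \<le> sharp_const \<theta> * L2_norm f"
    using L2_fatou[OF laplace_bound_interior(1)[OF \<theta>n(1) fn fn_int] le C laplace_measurable[OF f_meas] lim] by blast
qed

section \<open>Test functions and optimality\<close>

text \<open>One integral of t^(c - 1) over (0, 1) gives all data of the test powers: c = 2
  \<epsilon> their squared norm, c = \<epsilon> the hypothesis \<open>f_int\<close>, c = \<epsilon>
  + i (\<xi>0 - \<xi>) their Mellin transform.\<close>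

lemma integral_power_unit:
  fixes c :: complex
  assumes c: "Re c > 0"
  shows "integrable Rplus (\<lambda>t. if t < 1 then exp ((c - 1) * of_real (ln t)) else 0)"
    and "(\<integral>t. (if t < 1 then exp ((c - 1) * of_real (ln t)) else 0) \<partial>Rplus) = 1 / c"
proof -
  have c0: "c \<noteq> 0" using c by auto
  define h where "h t = exp ((c - 1) * of_real (ln t))" for t :: real
  have meas: "(\<lambda>t::real. if t < 1 then h t else 0) \<in> borel_measurable borel" unfolding h_def by measurable
  then have smeas: "set_borel_measurable borel {0<..} (\<lambda>t. if t < 1 then h t else 0)"
    by (auto simp: set_borel_measurable_def)
  have set_eq: "indicator {0<..} t *\<^sub>R (if t < 1 then h t else 0) = indicator {0<..<1} t *\<^sub>R h t" for t :: real
    by (auto simp: indicator_def)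
  have norm_h: "cmod (h t) = exp ((Re c - 1) * ln t)" for t by (simp add: h_def)
  have lim0: "((\<lambda>t. exp (Re c * ln t)) \<longlongrightarrow> 0) (at_right 0)" using c by real_asymp
  have lim1: "((\<lambda>t. exp (Re c * ln t)) \<longlongrightarrow> exp (Re c * ln 1)) (at_left 1)"
    by (intro tendsto_intros) auto
  have "set_integrable lborel (einterval 0 1) (\<lambda>t. exp ((Re c - 1) * ln t))"
  proof (rule interval_integral_FTC_nonneg)
    show "DERIV (\<lambda>t. exp (Re c * ln t) / Re c) t :> exp ((Re c - 1) * ln t)" if "0 < ereal t" for t
    proof -
      have "t > 0" using that by (simp add: zero_ereal_def)
      then have "exp ((Re c - 1) * ln t) = exp (Re c * ln t) / t"
        by (simp add: left_diff_distrib exp_diff)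
      then show ?thesis using c \<open>t > 0\<close> by (auto intro!: derivative_eq_intros)
    qed
    show "(((\<lambda>t. exp (Re c * ln t) / Re c) \<circ> real_of_ereal) \<longlongrightarrow> 0 / Re c) (at_right 0)"
      unfolding zero_ereal_def ereal_tendsto_simps using c by (intro tendsto_intros lim0) auto
    show "(((\<lambda>t. exp (Re c * ln t) / Re c) \<circ> real_of_ereal) \<longlongrightarrow> exp (Re c * ln 1) / Re c) (at_left 1)"
      unfolding one_ereal_def ereal_tendsto_simps using c by (intro tendsto_divide tendsto_const lim1) auto
  qed (auto simp: zero_ereal_def intro!: continuous_intros)
  then have "set_integrable lborel {0<..<1} (\<lambda>t. exp ((Re c - 1) * ln t))"
    by (simp add: zero_ereal_def one_ereal_def)
  then have sint: "set_integrable lborel {0<..<1} h"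
  proof (rule set_integrable_bound)
    show "set_borel_measurable lborel {0<..<1} h"
      unfolding set_borel_measurable_def h_def by measurable
  qed (auto simp: norm_h)
  then show "integrable Rplus (\<lambda>t. if t < 1 then exp ((c - 1) * of_real (ln t)) else 0)"
    unfolding h_def[symmetric] integrable_Rplus_iff[OF smeas] set_integrable_def set_eq .
  have "(LBINT t=0..1. h t) = exp (c * of_real (ln 1)) / c - 0 / c"
  proof (rule interval_integral_FTC_integrable)
    show "((\<lambda>t. exp (c * of_real (ln t)) / c) has_vector_derivative h t) (at t)" if "0 < ereal t" for t
    proof -
      have t: "t > 0" using that by (simp add: zero_ereal_def)
      have h_eq: "h t = exp (c * of_real (ln t)) / of_real t"
        using t by (simp add: h_def left_diff_distrib exp_diff exp_of_real)
      have "((\<lambda>t. of_real (ln t) :: complex) has_vector_derivative of_real (1 / t)) (at t)"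
        using t by (intro has_vector_derivative_of_real) (auto intro!: derivative_eq_intros
            simp flip: has_real_derivative_iff_has_vector_derivative)
      moreover have "((\<lambda>z. exp (c * z) / c) has_field_derivative exp (c * of_real (ln t))) (at (of_real (ln t)))"
        using c0 by (auto intro!: derivative_eq_intros)
      ultimately have "((\<lambda>t. exp (c * of_real (ln t)) / c) has_vector_derivative of_real (1 / t) * exp (c * of_real (ln t))) (at t)"
        using field_vector_diff_chain_at[of "\<lambda>t. of_real (ln t)" "of_real (1 / t)" t "\<lambda>z. exp (c * z) / c"]
        by (simp add: o_def)
      then show ?thesis by (simp add: h_eq)
    qed
    have "((\<lambda>t. exp (c * of_real (ln t))) \<longlongrightarrow> 0) (at_right 0)"
      by (rule tendsto_norm_zero_cancel) (use lim0 in simp)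
    then show "(((\<lambda>t. exp (c * of_real (ln t)) / c) \<circ> real_of_ereal) \<longlongrightarrow> 0 / c) (at_right 0)"
      unfolding zero_ereal_def ereal_tendsto_simps using c by (intro tendsto_intros) auto
    show "(((\<lambda>t. exp (c * of_real (ln t)) / c) \<circ> real_of_ereal) \<longlongrightarrow> exp (c * of_real (ln 1)) / c) (at_left 1)"
      unfolding one_ereal_def ereal_tendsto_simps using c by (intro tendsto_intros) auto
    show "isCont h t" if "0 < ereal t" for t
      using that unfolding h_def by (intro continuous_intros) (auto simp: zero_ereal_def)
  qed (use sint in \<open>auto simp: zero_ereal_def one_ereal_def\<close>)
  moreover have "(LBINT t=0..1. h t) = (LINT t:{0<..<1}|lborel. h t)"
    unfolding zero_ereal_def one_ereal_def by (simp add: interval_lebesgue_integral_le_eq)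
  ultimately have "(LINT t:{0<..<1}|lborel. h t) = 1 / c" by simp
  then show "(\<integral>t. (if t < 1 then exp ((c - 1) * of_real (ln t)) else 0) \<partial>Rplus) = 1 / c"
    unfolding h_def[symmetric] integral_Rplus[OF smeas] set_lebesgue_integral_def set_eq .
qed

text \<open>The test power has squared norm 1 / (2 \<epsilon>), while its squared Mellin transform 1
  / (\<epsilon>^2 + (\<xi> - \<xi>0)^2) has total mass pi / \<epsilon>. The ratio is 2 pi, so
  Plancherel loses nothing on these functions, and concentration at \<xi>0 leaves the value of the
  weight there.\<close>

lemma laplace_bound_ge_weight:
  assumes \<theta>: "\<bar>\<theta>\<bar> < pi / 2" and K: "laplace_bound \<theta> K"
  shows "0 \<le> K" "2 * pi * mellin_weight \<theta> \<xi>0 \<le> K\<^sup>2"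
proof -
  define f where "f \<epsilon> t = (if t < 1 then exp ((of_real \<epsilon> + 1 / 2 + \<i> * of_real \<xi>0 - 1) * of_real (ln t)) else 0)"
    for \<epsilon> t :: real
  have L1: "integrable Rplus (f \<epsilon>)" if "\<epsilon> > 0" for \<epsilon>
    unfolding f_def using that by (intro integral_power_unit) auto
  have norm_f: "cmod (f \<epsilon> t) = (if t < 1 then exp ((\<epsilon> - 1 / 2) * ln t) else 0)" for \<epsilon> t
    by (simp add: f_def)
  have sq: "complex_of_real ((cmod (f \<epsilon> t))\<^sup>2) =
      (if t < 1 then exp ((of_real (2 * \<epsilon>) - 1) * of_real (ln t)) else 0)" for \<epsilon> t
    by (simp add: norm_f power2_eq_square mult_exp_exp algebra_simps flip: exp_of_real)
  have sq_int: "integrable Rplus (\<lambda>t. (cmod (f \<epsilon> t))\<^sup>2)" if "\<epsilon> > 0" for \<epsilon>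
    using integral_power_unit(1)[of "of_real (2 * \<epsilon>)"] that
    unfolding sq[symmetric] complex_of_real_integrable_eq by simp
  have sq_val: "(\<integral>t. (cmod (f \<epsilon> t))\<^sup>2 \<partial>Rplus) = 1 / (2 * \<epsilon>)" if "\<epsilon> > 0" for \<epsilon>
  proof -
    have "complex_of_real (\<integral>t. (cmod (f \<epsilon> t))\<^sup>2 \<partial>Rplus) = 1 / of_real (2 * \<epsilon>)"
      using integral_power_unit(2)[of "of_real (2 * \<epsilon>)"] that
      unfolding sq[symmetric] integral_complex_of_real by simp
    also have "\<dots> = complex_of_real (1 / (2 * \<epsilon>))" by simp
    finally show ?thesis by (simp only: of_real_eq_iff)
  qed
  have f: "f \<epsilon> \<in> L1 \<inter> L2" if "\<epsilon> > 0" for \<epsilon>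
    using L1[OF that] sq_int[OF that] by (auto simp: L1_def L2_def)
  have damp: "complex_of_real (cmod (f \<epsilon> t) * exp (- ln t / 2)) =
      (if t < 1 then exp ((of_real \<epsilon> - 1) * of_real (ln t)) else 0)" for \<epsilon> t
  proof -
    have "cmod (f \<epsilon> t) * exp (- ln t / 2) = (if t < 1 then exp ((\<epsilon> - 1) * ln t) else 0)"
      by (simp add: norm_f mult_exp_exp field_simps)
    then show ?thesis by (simp flip: exp_of_real)
  qed
  have f_int: "integrable Rplus (\<lambda>t. cmod (f \<epsilon> t) * exp (- ln t / 2))" if "\<epsilon> > 0" for \<epsilon>
    using integral_power_unit(1)[of "of_real \<epsilon>"] that
    unfolding damp[symmetric] complex_of_real_integrable_eq by simp
  have mellin_f: "(cmod (mellin (f \<epsilon>) \<xi>))\<^sup>2 = 1 / (\<epsilon>\<^sup>2 + (\<xi> - \<xi>0)\<^sup>2)" if "\<epsilon> > 0" for \<epsilon> \<xi>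
  proof -
    have "mellin (f \<epsilon>) \<xi> = (\<integral>t. (if t < 1 then exp ((Complex \<epsilon> (\<xi>0 - \<xi>) - 1) * of_real (ln t)) else 0) \<partial>Rplus)"
      unfolding mellin_def f_def
      by (intro Bochner_Integration.integral_cong refl)
        (auto simp: mult_exp_exp Complex_eq algebra_simps)
    also have "\<dots> = 1 / Complex \<epsilon> (\<xi>0 - \<xi>)"
      using that by (intro integral_power_unit) auto
    finally show ?thesis
      by (simp add: norm_divide power_divide cmod_power2 power2_commute)
  qed
  have main: "integrable lborel (\<lambda>\<xi>. mellin_weight \<theta> \<xi> * (1 / (\<epsilon>\<^sup>2 + (\<xi> - \<xi>0)\<^sup>2)))"
     "(\<integral>\<xi>. mellin_weight \<theta> \<xi> * (1 / (\<epsilon>\<^sup>2 + (\<xi> - \<xi>0)\<^sup>2)) \<partial>lborel) \<le> K\<^sup>2 / (2 * \<epsilon>)"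
     "K \<ge> 0" if "\<epsilon> > 0" for \<epsilon>
  proof -
    have fe: "integrable Rplus (f \<epsilon>)" "f \<epsilon> \<in> borel_measurable Rplus" using L1[OF that] by auto
    have le: "L2_norm (laplace \<theta> (f \<epsilon>)) \<le> K * L2_norm (f \<epsilon>)"
      using K f[OF that] by (auto simp: laplace_bound_def)
    have norm_f: "L2_norm (f \<epsilon>) = sqrt (1 / (2 * \<epsilon>))" by (simp add: L2_norm_def sq_val[OF that])
    have "0 \<le> K * L2_norm (f \<epsilon>)" using le L2_norm_nonneg order_trans by blast
    then show "K \<ge> 0" using that by (simp add: norm_f zero_le_mult_iff)
    show "integrable lborel (\<lambda>\<xi>. mellin_weight \<theta> \<xi> * (1 / (\<epsilon>\<^sup>2 + (\<xi> - \<xi>0)\<^sup>2)))"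
      unfolding mellin_f[OF that, symmetric]
      by (rule mellin_weighted_norm(1)[OF fourier_mellin_weight(1)[OF \<theta>] _ fe(2) f_int[OF that]])
        (simp add: mellin_weight_def)
    have "(\<integral>\<xi>. mellin_weight \<theta> \<xi> * (1 / (\<epsilon>\<^sup>2 + (\<xi> - \<xi>0)\<^sup>2)) \<partial>lborel) = (L2_norm (laplace \<theta> (f \<epsilon>)))\<^sup>2"
      unfolding mellin_f[OF that, symmetric]
      by (simp add: laplace_norm_eq_mellin(2)[OF \<theta> fe(1) f_int[OF that], symmetric] L2_norm_def)
    also have "\<dots> \<le> (K * L2_norm (f \<epsilon>))\<^sup>2" using le by (intro power_mono) auto
    also have "\<dots> = K\<^sup>2 / (2 * \<epsilon>)" using that by (simp add: norm_f power_mult_distrib)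
    finally show "(\<integral>\<xi>. mellin_weight \<theta> \<xi> * (1 / (\<epsilon>\<^sup>2 + (\<xi> - \<xi>0)\<^sup>2)) \<partial>lborel) \<le> K\<^sup>2 / (2 * \<epsilon>)" .
  qed
  show "0 \<le> K" using main(3)[of 1] by simp
  \<comment> \<open>By continuity, v stays below the weight near \<xi>0. As \<epsilon> tends to 0
    that neighbourhood captures the full mass of the kernel, and afterwards v may rise to the weight
    at \<xi>0.\<close>
  have "2 * pi * v \<le> K\<^sup>2" if v: "v < mellin_weight \<theta> \<xi>0" for v
  proof -
    have "isCont (mellin_weight \<theta>) \<xi>0"
      unfolding mellin_weight_def by (intro continuous_intros) auto
    then have "\<forall>\<^sub>F \<xi> in nhds \<xi>0. v < mellin_weight \<theta> \<xi>"
      using v by (simp add: continuous_at_imp_continuous_within isCont_def tendsto_nhds_iff order_tendstoD(1))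
    then obtain \<delta> where \<delta>: "\<delta> > 0" "\<And>\<xi>. dist \<xi> \<xi>0 \<le> \<delta> \<Longrightarrow> v < mellin_weight \<theta> \<xi>"
      unfolding eventually_nhds_metric_le by blast
    \<comment> \<open>This is v * 2 arctan (\<delta> / \<epsilon>) / \<epsilon> \<le> K^2 / (2
      \<epsilon>), multiplied by 2 \<epsilon>.\<close>
    have le: "4 * v * arctan (\<delta> / \<epsilon>) \<le> K\<^sup>2" if \<epsilon>: "\<epsilon> > 0" for \<epsilon>
    proof -
      define p where "p \<xi> = 1 / (\<epsilon>\<^sup>2 + (\<xi> - \<xi>0)\<^sup>2)" for \<xi>
      have pos: "\<epsilon>\<^sup>2 + (\<xi> - \<xi>0)\<^sup>2 > 0" for \<xi> using \<epsilon> by (simp add: add_pos_nonneg)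
      have ftc: "has_bochner_integral lborel (\<lambda>\<xi>. p \<xi> * indicator {\<xi>0 - \<delta>..\<xi>0 + \<delta>} \<xi>)
        (arctan ((\<xi>0 + \<delta> - \<xi>0) / \<epsilon>) / \<epsilon> - arctan ((\<xi>0 - \<delta> - \<xi>0) / \<epsilon>) / \<epsilon>)"
      proof (rule has_bochner_integral_FTC_Icc_real)
        show "DERIV (\<lambda>\<xi>. arctan ((\<xi> - \<xi>0) / \<epsilon>) / \<epsilon>) \<xi> :> p \<xi>" for \<xi>
        proof -
          have "1 + ((\<xi> - \<xi>0) / \<epsilon>)\<^sup>2 = (\<epsilon>\<^sup>2 + (\<xi> - \<xi>0)\<^sup>2) / \<epsilon>\<^sup>2"
            using \<epsilon> by (simp add: power_divide field_simps)
          then have "inverse (1 + ((\<xi> - \<xi>0) / \<epsilon>)\<^sup>2) * (1 / \<epsilon>) / \<epsilon> = p \<xi>"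
            using \<epsilon> by (simp add: p_def power2_eq_square)
          moreover have "DERIV (\<lambda>\<xi>. arctan ((\<xi> - \<xi>0) / \<epsilon>) / \<epsilon>) \<xi> :> inverse (1 + ((\<xi> - \<xi>0) / \<epsilon>)\<^sup>2) * (1 / \<epsilon>) / \<epsilon>"
            using \<epsilon> by (auto intro!: derivative_eq_intros)
          ultimately show ?thesis by simp
        qed
        show "isCont p \<xi>" for \<xi>
          unfolding p_def using pos by (intro continuous_intros) (auto simp: less_imp_neq[symmetric])
      qed (use \<delta> in auto)
      have "v * (2 * arctan (\<delta> / \<epsilon>) / \<epsilon>) =
          (\<integral>\<xi>. v * (p \<xi> * indicator {\<xi>0 - \<delta>..\<xi>0 + \<delta>} \<xi>) \<partial>lborel)"
        using has_bochner_integral_integral_eq[OF ftc] by (simp add: arctan_minus)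
      also have "\<dots> \<le> (\<integral>\<xi>. mellin_weight \<theta> \<xi> * p \<xi> \<partial>lborel)"
      proof (rule integral_mono)
        show "integrable lborel (\<lambda>\<xi>. v * (p \<xi> * indicator {\<xi>0 - \<delta>..\<xi>0 + \<delta>} \<xi>))"
          using ftc by (auto simp: has_bochner_integral_iff)
        show "integrable lborel (\<lambda>\<xi>. mellin_weight \<theta> \<xi> * p \<xi>)" unfolding p_def by (rule main(1)[OF \<epsilon>])
        show "v * (p \<xi> * indicator {\<xi>0 - \<delta>..\<xi>0 + \<delta>} \<xi>) \<le> mellin_weight \<theta> \<xi> * p \<xi>" for \<xi>
        proof -
          have "p \<xi> \<ge> 0" using pos[of \<xi>] by (simp add: p_def)
          moreover have "mellin_weight \<theta> \<xi> \<ge> 0" by (simp add: mellin_weight_def)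
          moreover have "v \<le> mellin_weight \<theta> \<xi>" if "\<xi> \<in> {\<xi>0 - \<delta>..\<xi>0 + \<delta>}"
            using that \<delta>(2)[of \<xi>] by (auto simp: dist_real_def abs_le_iff)
          ultimately show ?thesis by (auto simp: indicator_def intro!: mult_right_mono)
        qed
      qed
      also have "\<dots> \<le> K\<^sup>2 / (2 * \<epsilon>)" unfolding p_def by (rule main(2)[OF \<epsilon>])
      finally show ?thesis using \<epsilon> by (simp add: field_simps)
    qed
    have "filterlim (\<lambda>\<epsilon>. \<delta> / \<epsilon>) at_top (at_right 0)" using \<delta>(1) by real_asymp
    then have "((\<lambda>\<epsilon>. 4 * v * arctan (\<delta> / \<epsilon>)) \<longlongrightarrow> 4 * v * (pi / 2)) (at_right 0)"
      by (intro tendsto_intros filterlim_compose[OF tendsto_arctan_at_top])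
    then have "4 * v * (pi / 2) \<le> K\<^sup>2"
      by (rule tendsto_upperbound) (auto simp: eventually_at_right_less intro!: eventually_mono[OF eventually_at_right_less] le)
    then show ?thesis by (simp add: mult_ac)
  qed
  then have "v * (2 * pi) \<le> K\<^sup>2" if "v < mellin_weight \<theta> \<xi>0" for v
    using that by (simp only: mult.commute[of v])
  then have "v \<le> K\<^sup>2 / (2 * pi)" if "v < mellin_weight \<theta> \<xi>0" for v
    using that by (subst pos_le_divide_eq) auto
  then have "mellin_weight \<theta> \<xi>0 \<le> K\<^sup>2 / (2 * pi)"
    by (rule dense_le)
  then show "2 * pi * mellin_weight \<theta> \<xi>0 \<le> K\<^sup>2" by (simp add: field_simps)
qed

text \<open>The transform is 1 / (1 + i (\<rho> - \<omega>)), a resonance at \<rho> = \<omega>. Its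
  squared modulus has mass pi on the whole line; the half-line captures pi / 2 + arctan \<omega>,
  hence all of it in the limit. Dividing by the squared norm 1 / 2 gives 2 pi.\<close>

lemma laplace_bound_half_pi:
  assumes K: "laplace_bound (pi / 2) K"
  shows "sqrt (2 * pi) \<le> K"
proof -
  define f where "f \<omega> t = exp (- (complex_of_real t * Complex 1 (- \<omega>)))" for \<omega> t :: real
  have L1: "integrable Rplus (f \<omega>)" for \<omega>
    unfolding f_def by (rule integral_exp_decay) simp
  have sq: "complex_of_real ((cmod (f \<omega> t))\<^sup>2) = exp (- (of_real t * 2))" for \<omega> t
    by (simp add: f_def exp_of_real[symmetric] mult.commute flip: exp_of_nat_mult)
  have sq_int: "integrable Rplus (\<lambda>t. (cmod (f \<omega> t))\<^sup>2)" for \<omega>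
    using integral_exp_decay(1)[of 2] unfolding sq[of \<omega>, symmetric] complex_of_real_integrable_eq by simp
  have sq_val: "(\<integral>t. (cmod (f \<omega> t))\<^sup>2 \<partial>Rplus) = 1 / 2" for \<omega>
  proof -
    have "complex_of_real (\<integral>t. (cmod (f \<omega> t))\<^sup>2 \<partial>Rplus) = complex_of_real (1 / 2)"
      using integral_exp_decay(2)[of 2] unfolding sq[of \<omega>, symmetric] integral_complex_of_real by simp
    then show ?thesis by (simp only: of_real_eq_iff)
  qed
  have f: "f \<omega> \<in> L1 \<inter> L2" for \<omega>
    using L1 sq_int borel_measurable_integrable[OF L1] by (auto simp: L1_def L2_def)
  have Lf: "laplace (pi / 2) (f \<omega>) \<rho> = 1 / Complex 1 (\<rho> - \<omega>)" for \<omega> \<rho>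
  proof -
    have "exp (\<i> * complex_of_real (pi / 2)) = \<i>"
      using cis_pi_half by (simp add: cis_conv_exp)
    then have "laplace (pi / 2) (f \<omega>) \<rho> = (\<integral>t. exp (- (complex_of_real t * Complex 1 (\<rho> - \<omega>))) \<partial>Rplus)"
      unfolding laplace_def f_def mult_exp_exp by (simp add: Complex_eq algebra_simps)
    also have "\<dots> = 1 / Complex 1 (\<rho> - \<omega>)" by (rule integral_exp_decay) simp
    finally show ?thesis .
  qed
  define h where "h \<omega> \<rho> = 1 / (1 + (\<rho> - \<omega>)\<^sup>2)" for \<omega> \<rho> :: real
  have norm_Lf: "(cmod (laplace (pi / 2) (f \<omega>) \<rho>))\<^sup>2 = h \<omega> \<rho>" for \<omega> \<rho>
    by (simp add: Lf h_def norm_divide power_divide cmod_power2)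
  have h_val: "(\<integral>\<rho>. h \<omega> \<rho> \<partial>Rplus) = pi / 2 + arctan \<omega>" for \<omega>
  proof -
    have "(LBINT \<rho>=0..\<infinity>. h \<omega> \<rho>) = pi / 2 - arctan (0 - \<omega>)"
    proof (rule interval_integral_FTC_nonneg)
      show "DERIV (\<lambda>\<rho>. arctan (\<rho> - \<omega>)) \<rho> :> h \<omega> \<rho>" for \<rho>
        unfolding h_def by (auto intro!: derivative_eq_intros simp: inverse_eq_divide)
      have "1 + (\<rho> - \<omega>)\<^sup>2 \<noteq> 0" for \<rho> by (metis add_pos_nonneg less_numeral_extra(1,3) zero_le_power2)
      then show "isCont (h \<omega>) \<rho>" for \<rho> unfolding h_def by (intro continuous_intros) auto
      show "(((\<lambda>\<rho>. arctan (\<rho> - \<omega>)) \<circ> real_of_ereal) \<longlongrightarrow> arctan (0 - \<omega>)) (at_right 0)"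
        unfolding zero_ereal_def ereal_tendsto_simps by (intro tendsto_intros)
      have "filterlim (\<lambda>\<rho>. \<rho> - \<omega>) at_top at_top" by real_asymp
      then show "(((\<lambda>\<rho>. arctan (\<rho> - \<omega>)) \<circ> real_of_ereal) \<longlongrightarrow> pi / 2) (at_left \<infinity>)"
        unfolding ereal_tendsto_simps by (rule filterlim_compose[OF tendsto_arctan_at_top])
    qed (auto simp: h_def)
    moreover have "set_borel_measurable borel {0<..} (h \<omega>)"
      unfolding set_borel_measurable_def h_def by measurable
    ultimately show ?thesis
      by (simp add: integral_Rplus interval_lebesgue_integral_0_infty arctan_minus)
  qed
  have le: "L2_norm (laplace (pi / 2) (f \<omega>)) \<le> K * L2_norm (f \<omega>)" for \<omega>
    using K f by (auto simp: laplace_bound_def)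
  have norm_f: "L2_norm (f \<omega>) = sqrt (1 / 2)" for \<omega> by (simp add: L2_norm_def sq_val)
  have "0 \<le> K * L2_norm (f 0)" using le[of 0] L2_norm_nonneg order_trans by blast
  then have K_pos: "K \<ge> 0" by (simp add: norm_f zero_le_mult_iff)
  have bound: "pi / 2 + arctan \<omega> \<le> K\<^sup>2 / 2" for \<omega>
  proof -
    have "pi / 2 + arctan \<omega> = (L2_norm (laplace (pi / 2) (f \<omega>)))\<^sup>2"
      using arctan_lbound[of \<omega>] by (simp add: L2_norm_def norm_Lf h_val)
    also have "\<dots> \<le> (K * L2_norm (f \<omega>))\<^sup>2" using le by (intro power_mono) auto
    also have "\<dots> = K\<^sup>2 / 2" by (simp add: norm_f power_mult_distrib power_divide)
    finally show ?thesis .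
  qed
  have "((\<lambda>\<omega>. pi / 2 + arctan \<omega>) \<longlongrightarrow> pi / 2 + pi / 2) at_top"
    by (intro tendsto_intros tendsto_arctan_at_top)
  then have "pi / 2 + pi / 2 \<le> K\<^sup>2 / 2"
    by (rule tendsto_upperbound) (use bound in auto)
  then have "2 * pi \<le> K\<^sup>2" by simp
  then show ?thesis using K_pos by (rule real_le_lsqrt[rotated])
qed

section \<open>Reflection of the angle and the set of admissible constants\<close>

lemma laplace_cnj: "laplace (- \<theta>) (\<lambda>t. cnj (f t)) \<rho> = cnj (laplace \<theta> f \<rho>)"
proof -
  have "cnj (f t * exp (- (complex_of_real (\<rho> * t) * exp (\<i> * complex_of_real \<theta>)))) =
    cnj (f t) * exp (- (complex_of_real (\<rho> * t) * exp (\<i> * complex_of_real (- \<theta>))))" for t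
    by (simp add: exp_cnj)
  then have "laplace (- \<theta>) (\<lambda>t. cnj (f t)) \<rho> =
      (\<integral>t. cnj (f t * exp (- (complex_of_real (\<rho> * t) * exp (\<i> * complex_of_real \<theta>)))) \<partial>Rplus)"
    unfolding laplace_def by (simp only:)
  moreover have "(\<integral>t. cnj (h t) \<partial>Rplus) = cnj (\<integral>t. h t \<partial>Rplus)" for h
    by (rule integral_bounded_linear'[OF bounded_linear_cnj bounded_linear_cnj]) simp
  ultimately show ?thesis by (simp only: laplace_def)
qed

text \<open>Conjugating a function and its transform reverses the angle and preserves both norms;
  this transfers the lower bound at pi / 2 to - pi / 2.\<close>

lemma laplace_bound_minus:
  assumes "laplace_bound \<theta> K"
  shows "laplace_bound (- \<theta>) K"
  unfolding laplace_bound_def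
proof
  fix f assume f: "f \<in> L1 \<inter> L2"
  have "(\<lambda>t. cnj (f t)) \<in> L1 \<inter> L2"
    using f by (auto simp: L1_def L2_def)
  then have "laplace \<theta> (\<lambda>t. cnj (f t)) \<in> L2"
      "L2_norm (laplace \<theta> (\<lambda>t. cnj (f t))) \<le> K * L2_norm (\<lambda>t. cnj (f t))"
    using assms by (auto simp: laplace_bound_def)
  moreover have "laplace (- \<theta>) f \<rho> = cnj (laplace \<theta> (\<lambda>t. cnj (f t)) \<rho>)" for \<rho>
    using laplace_cnj[of \<theta> "\<lambda>t. cnj (f t)" \<rho>] by simp
  moreover have "laplace (- \<theta>) f \<in> borel_measurable Rplus"
    using f by (intro laplace_measurable) (auto simp: L2_def)
  ultimately show "laplace (- \<theta>) f \<in> L2 \<and> L2_norm (laplace (- \<theta>) f) \<le> K * L2_norm f"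
    by (simp add: L2_def L2_norm_def)
qed

text \<open>The admissible constants form a closed ray, so the infimum in \<open>K1\<close> is a
  minimum.\<close>

lemma laplace_bound_iff:
  assumes \<theta>: "\<theta> \<in> {-pi/2..pi/2}"
  shows "laplace_bound \<theta> K \<longleftrightarrow> sharp_const \<theta> \<le> K"
proof
  assume K: "laplace_bound \<theta> K"
  consider "\<bar>\<theta>\<bar> < pi / 2" | "\<theta> = pi / 2" | "\<theta> = - (pi / 2)" using \<theta> by fastforce
  then show "sharp_const \<theta> \<le> K"
  proof cases
    case 1
    obtain \<xi> where "2 * pi * mellin_weight \<theta> \<xi> = (sharp_const \<theta>)\<^sup>2" using mellin_weight_le(2)[OF 1] by blast
    then have "(sharp_const \<theta>)\<^sup>2 \<le> K\<^sup>2" using laplace_bound_ge_weight(2)[OF 1 K, of \<xi>] by simp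
    then show ?thesis using laplace_bound_ge_weight(1)[OF 1 K] by (rule power2_le_imp_le)
  next
    case 2
    show ?thesis
      using laplace_bound_half_pi[of K] K sharp_const_half_pi[of "pi / 2"] unfolding 2 by simp
  next
    case 3
    show ?thesis
      using laplace_bound_half_pi[of K] laplace_bound_minus[OF K] sharp_const_half_pi[of "- (pi / 2)"]
      unfolding 3 by simp
  qed
next
  assume le: "sharp_const \<theta> \<le> K"
  have "sharp_const \<theta> * L2_norm f \<le> K * L2_norm f" for f
    using le by (rule mult_right_mono) simp
  then show "laplace_bound \<theta> K"
    using laplace_bound_sharp_const[OF \<theta>] unfolding laplace_bound_def by (meson order_trans)
qed

lemma K1_eq:
  assumes "\<theta> \<in> {-pi/2..pi/2}"
  shows "K1 \<theta> = sharp_const \<theta>"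
proof -
  have "{K. laplace_bound \<theta> K} = {sharp_const \<theta>..}" using laplace_bound_iff[OF assms] by auto
  then show ?thesis by (simp add: K1_def)
qed

section \<open>Extension to square-integrable functions\<close>

text \<open>Minkowski's inequality from a pointwise estimate with weights a and b. Taking them
  strictly above the two norms keeps the denominators positive even if a norm is 0; the slack then
  tends to 0.\<close>

lemma L2_add:
  assumes f: "f \<in> L2" and g: "g \<in> L2"
  shows "(\<lambda>x. f x + g x) \<in> L2" "L2_norm (\<lambda>x. f x + g x) \<le> L2_norm f + L2_norm g"
proof -
  have [measurable]: "f \<in> borel_measurable Rplus" "g \<in> borel_measurable Rplus"
    using f g by (auto simp: L2_def)
  have weighted: "(\<lambda>x. f x + g x) \<in> L2 \<and> L2_norm (\<lambda>x. f x + g x) \<le> a + b"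
    if a: "L2_norm f < a" and b: "L2_norm g < b" for a b
  proof -
    have ab: "a > 0" "b > 0" using a b L2_norm_nonneg[of f] L2_norm_nonneg[of g] by linarith+
    have pt: "(cmod (f x + g x))\<^sup>2 \<le> (a + b) / a * (cmod (f x))\<^sup>2 + (a + b) / b * (cmod (g x))\<^sup>2" for x
    proof -
      define u v where "u = cmod (f x)" and "v = cmod (g x)"
      have "(cmod (f x + g x))\<^sup>2 \<le> (u + v)\<^sup>2"
        unfolding u_def v_def by (intro power_mono norm_triangle_ineq) auto
      \<comment> \<open>Adding (b u - a v)^2 / (a b) cancels the mixed term 2 u v.\<close>
      also have "(u + v)\<^sup>2 \<le> (u + v)\<^sup>2 + (b * u - a * v)\<^sup>2 / (a * b)" using ab by simp
      also have "\<dots> = (a + b) / a * u\<^sup>2 + (a + b) / b * v\<^sup>2"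
        using ab by (simp add: field_simps power2_eq_square)
      finally show ?thesis unfolding u_def v_def .
    qed
    have lin: "ennreal ((a + b) / a * u + (a + b) / b * v) =
        ennreal ((a + b) / a) * ennreal u + ennreal ((a + b) / b) * ennreal v"
      if "0 \<le> u" "0 \<le> v" for u v
    proof -
      have "0 \<le> (a + b) / a" "0 \<le> (a + b) / b" using ab by auto
      then show ?thesis
        using that by (simp only: ennreal_plus ennreal_mult mult_nonneg_nonneg)
    qed
    have "(\<integral>\<^sup>+x. ennreal ((cmod (f x + g x))\<^sup>2) \<partial>Rplus) \<le>
      (\<integral>\<^sup>+x. ennreal ((a + b) / a) * ennreal ((cmod (f x))\<^sup>2) + ennreal ((a + b) / b) * ennreal ((cmod (g x))\<^sup>2) \<partial>Rplus)"
    proof (rule nn_integral_mono)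
      fix x
      have "ennreal ((cmod (f x + g x))\<^sup>2) \<le> ennreal ((a + b) / a * (cmod (f x))\<^sup>2 + (a + b) / b * (cmod (g x))\<^sup>2)"
        by (rule ennreal_leI[OF pt])
      also have "\<dots> = ennreal ((a + b) / a) * ennreal ((cmod (f x))\<^sup>2) + ennreal ((a + b) / b) * ennreal ((cmod (g x))\<^sup>2)"
        by (rule lin) auto
      finally show "ennreal ((cmod (f x + g x))\<^sup>2) \<le> \<dots>" .
    qed
    also have "\<dots> = ennreal ((a + b) / a) * ennreal ((L2_norm f)\<^sup>2) + ennreal ((a + b) / b) * ennreal ((L2_norm g)\<^sup>2)"
      by (simp add: nn_integral_add nn_integral_cmult nn_integral_L2_norm[OF f] nn_integral_L2_norm[OF g])
    also have "\<dots> = ennreal ((a + b) / a * (L2_norm f)\<^sup>2 + (a + b) / b * (L2_norm g)\<^sup>2)"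
      by (rule lin[symmetric]) auto
    also have "\<dots> \<le> ennreal ((a + b)\<^sup>2)"
    proof (rule ennreal_leI)
      have "(a + b) / a * (L2_norm f)\<^sup>2 + (a + b) / b * (L2_norm g)\<^sup>2 \<le> (a + b) / a * a\<^sup>2 + (a + b) / b * b\<^sup>2"
        using a b ab by (intro add_mono mult_left_mono power_mono) auto
      also have "\<dots> = (a + b)\<^sup>2" using ab by (simp add: field_simps power2_eq_square)
      finally show "(a + b) / a * (L2_norm f)\<^sup>2 + (a + b) / b * (L2_norm g)\<^sup>2 \<le> (a + b)\<^sup>2" .
    qed
    finally show ?thesis using L2I[of "\<lambda>x. f x + g x" "a + b"] ab by auto
  qed
  show "(\<lambda>x. f x + g x) \<in> L2"
    using weighted[of "L2_norm f + 1" "L2_norm g + 1"] by simp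
  show "L2_norm (\<lambda>x. f x + g x) \<le> L2_norm f + L2_norm g"
  proof (rule field_le_epsilon)
    fix e :: real assume "e > 0"
    then show "L2_norm (\<lambda>x. f x + g x) \<le> L2_norm f + L2_norm g + e"
      using weighted[of "L2_norm f + e / 2" "L2_norm g + e / 2"] by simp
  qed
qed

lemma L2_cmult:
  assumes "f \<in> L2"
  shows "(\<lambda>x. c * f x) \<in> L2" "L2_norm (\<lambda>x. c * f x) = cmod c * L2_norm f"
  using assms by (auto simp: L2_def L2_norm_def norm_mult power_mult_distrib real_sqrt_mult)

lemma L2_diff:
  assumes "f \<in> L2" "g \<in> L2"
  shows "(\<lambda>x. f x - g x) \<in> L2" "L2_norm (\<lambda>x. f x - g x) \<le> L2_norm f + L2_norm g"
  using L2_add[OF assms(1) L2_cmult(1)[OF assms(2), of "-1"]] L2_cmult(2)[OF assms(2), of "-1"] by auto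

lemma L2_norm_minus_commute: "L2_norm (\<lambda>x. f x - g x) = L2_norm (\<lambda>x. g x - f x)"
  by (simp add: L2_norm_def norm_minus_commute)

lemma L2_triangle:
  assumes "f \<in> L2" "g \<in> L2" "h \<in> L2"
  shows "L2_norm (\<lambda>x. f x - g x) \<le> L2_norm (\<lambda>x. f x - h x) + L2_norm (\<lambda>x. g x - h x)"
  using L2_diff(2)[OF L2_diff(1)[OF assms(1,3)] L2_diff(1)[OF assms(2,3)]] by simp

lemma L2_norm_eq_0_iff:
  assumes "f \<in> L2"
  shows "L2_norm f = 0 \<longleftrightarrow> (AE x in Rplus. f x = 0)"
  using assms by (auto simp: L2_def L2_norm_def integral_nonneg_eq_0_iff_AE)

lemma AE_eq_if_L2_norm_le_0:
  assumes "f \<in> L2" "g \<in> L2" "L2_norm (\<lambda>x. f x - g x) \<le> 0"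
  shows "AE x in Rplus. f x = g x"
  using assms L2_norm_eq_0_iff[OF L2_diff(1)[OF assms(1,2)]] L2_norm_nonneg[of "\<lambda>x. f x - g x"] by simp

text \<open>Restriction to (0, n]: on a set of finite measure, square-integrability implies
  integrability. The bound on the norm of h keeps the constant sharp when the operator norm is
  computed.\<close>

lemma L1_L2_dense:
  assumes f: "f \<in> L2" and "e > 0"
  obtains h where "h \<in> L1 \<inter> L2" "L2_norm (\<lambda>x. f x - h x) < e" "L2_norm h \<le> L2_norm f"
proof -
  have f_meas [measurable]: "f \<in> borel_measurable Rplus" and f2: "integrable Rplus (\<lambda>t. (cmod (f t))\<^sup>2)"
    using f by (auto simp: L2_def)
  define h where "h n t = (if t \<le> real n then f t else 0)" for n t
  have h_meas [measurable]: "h n \<in> borel_measurable Rplus" for n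
  proof -
    note measurable_ident_Rplus [measurable]
    show ?thesis unfolding h_def by measurable
  qed
  have h_L2: "h n \<in> L2" "L2_norm (h n) \<le> L2_norm f" for n
    by (rule L2_norm_mono[OF f h_meas]; simp add: h_def)+
  have h_L1: "h n \<in> L1" for n
  proof -
    have "integrable Rplus (\<lambda>t::real. indicator {0<..real n} t :: real)"
    proof (rule integrable_real_indicator)
      show "{0<..real n} \<in> sets Rplus" by (simp add: sets_restrict_space_iff subset_iff)
      have "emeasure Rplus {0<..real n} = emeasure lebesgue {0<..real n}"
        by (rule emeasure_restrict_space) auto
      then show "emeasure Rplus {0<..real n} < \<infinity>" by simp
    qed
    then have "integrable Rplus (\<lambda>t. indicator {0<..real n} t + (cmod (f t))\<^sup>2)"
      using f2 by simp
    then have "integrable Rplus (h n)"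
    proof (rule Bochner_Integration.integrable_bound[OF _ h_meas AE_I2])
      fix t assume "t \<in> space Rplus"
      \<comment> \<open>From 2 x \<le> x^2 + 1 with x \<ge> 0.\<close>
      moreover have "cmod (f t) \<le> 1 + (cmod (f t))\<^sup>2"
        using sum_squares_bound[of "cmod (f t)" 1] norm_ge_zero[of "f t"] by (simp only: power_one mult_1_right)
      ultimately show "norm (h n t) \<le> norm (indicator {0<..real n} t + (cmod (f t))\<^sup>2)"
        by (auto simp: h_def indicator_def)
    qed
    then show ?thesis by (simp add: L1_def)
  qed
  have "(\<lambda>n. \<integral>t. (cmod (f t - h n t))\<^sup>2 \<partial>Rplus) \<longlonglongrightarrow> (\<integral>t. 0 \<partial>Rplus)"
  proof (rule integral_dominated_convergence[OF _ _ f2])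
    show "AE t in Rplus. (\<lambda>n. (cmod (f t - h n t))\<^sup>2) \<longlonglongrightarrow> 0"
    proof (intro AE_I2 tendsto_eventually)
      fix t
      have "\<forall>\<^sub>F n in sequentially. t \<le> real n" by real_asymp
      then show "\<forall>\<^sub>F n in sequentially. (cmod (f t - h n t))\<^sup>2 = 0"
        by eventually_elim (simp add: h_def)
    qed
    show "AE t in Rplus. norm ((cmod (f t - h n t))\<^sup>2) \<le> (cmod (f t))\<^sup>2" for n
      by (auto simp: h_def)
  qed auto
  then have "(\<lambda>n. L2_norm (\<lambda>x. f x - h n x)) \<longlonglongrightarrow> sqrt 0"
    unfolding L2_norm_def by (intro tendsto_real_sqrt) simp
  then have "\<forall>\<^sub>F n in sequentially. L2_norm (\<lambda>x. f x - h n x) < e"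
    using \<open>e > 0\<close> by (intro order_tendstoD(2)) auto
  then obtain n where "L2_norm (\<lambda>x. f x - h n x) < e"
    using eventually_happens by fastforce
  then show ?thesis using that h_L1 h_L2 by blast
qed

lemma L1_L2_closed:
  assumes "f \<in> L1 \<inter> L2" "g \<in> L1 \<inter> L2"
  shows "(\<lambda>x. f x + g x) \<in> L1 \<inter> L2" "(\<lambda>x. f x - g x) \<in> L1 \<inter> L2" "(\<lambda>x. c * f x) \<in> L1 \<inter> L2"
  using assms L2_add(1)[of f g] L2_diff(1)[of f g] L2_cmult(1)[of f c] by (auto simp: L1_def)

section \<open>Linearity and continuity of the transform on L1 and L2\<close>

lemma laplace_integrable:
  assumes \<theta>: "\<theta> \<in> {-pi/2..pi/2}" and f: "f \<in> L1" and \<rho>: "\<rho> > 0"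
  shows "integrable Rplus (\<lambda>t. f t * exp (- (complex_of_real (\<rho> * t) * exp (\<i> * complex_of_real \<theta>))))"
proof -
  have f': "integrable Rplus f" using f by (simp add: L1_def)
  then have [measurable]: "f \<in> borel_measurable Rplus" by auto
  note measurable_ident_Rplus [measurable]
  show ?thesis
  proof (rule Bochner_Integration.integrable_bound[OF f' _ AE_I2])
    fix t assume "t \<in> space Rplus"
    moreover have "cos \<theta> \<ge> 0" using \<theta> by (intro cos_ge_zero) auto
    ultimately show "norm (f t * exp (- (complex_of_real (\<rho> * t) * exp (\<i> * complex_of_real \<theta>)))) \<le> norm (f t)"
      using \<rho> by (auto simp: norm_mult Re_exp intro!: mult_left_le)
  qed measurable
qed

lemma laplace_linear:
  assumes \<theta>: "\<theta> \<in> {-pi/2..pi/2}" and f: "f \<in> L1" and g: "g \<in> L1" and \<rho>: "\<rho> > 0"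
  shows "laplace \<theta> (\<lambda>x. f x + g x) \<rho> = laplace \<theta> f \<rho> + laplace \<theta> g \<rho>"
    "laplace \<theta> (\<lambda>x. f x - g x) \<rho> = laplace \<theta> f \<rho> - laplace \<theta> g \<rho>"
  using laplace_integrable[OF \<theta> f \<rho>] laplace_integrable[OF \<theta> g \<rho>]
  by (simp_all add: laplace_def distrib_right left_diff_distrib)

lemma laplace_cmult: "laplace \<theta> (\<lambda>x. c * f x) \<rho> = c * laplace \<theta> f \<rho>"
  by (simp add: laplace_def mult.assoc)

lemma laplace_bound_diff:
  assumes \<theta>: "\<theta> \<in> {-pi/2..pi/2}" and K: "laplace_bound \<theta> K"
    and f: "f \<in> L1 \<inter> L2" and g: "g \<in> L1 \<inter> L2"
  shows "L2_norm (\<lambda>x. laplace \<theta> f x - laplace \<theta> g x) \<le> K * L2_norm (\<lambda>x. f x - g x)"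
proof -
  have fg: "(\<lambda>x. f x - g x) \<in> L1 \<inter> L2" by (rule L1_L2_closed[OF f g])
  have "L2_norm (\<lambda>x. laplace \<theta> f x - laplace \<theta> g x) = L2_norm (laplace \<theta> (\<lambda>x. f x - g x))"
    unfolding L2_norm_def using f g
    by (intro arg_cong[where f = sqrt] Bochner_Integration.integral_cong refl) (simp add: laplace_linear[OF \<theta>])
  then show ?thesis using K fg by (simp add: laplace_bound_def)
qed

section \<open>Completeness and the extended operator\<close>

lemma convergent_if_summable_diff:
  fixes X :: "nat \<Rightarrow> 'a::banach"
  assumes "summable (\<lambda>n. X (Suc n) - X n)"
  shows "convergent X"
proof -
  have "(\<lambda>n. (\<Sum>k<n. X (Suc k) - X k) + X 0) \<longlonglongrightarrow> suminf (\<lambda>n. X (Suc n) - X n) + X 0"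
    by (intro tendsto_intros summable_LIMSEQ assms)
  then show ?thesis unfolding sum_lessThan_telescope by (auto simp: convergent_def)
qed

text \<open>The Riesz--Fischer argument. The integral of 4^n times the squared modulus of
  \<open>d n\<close> is at most C^2 / 4^n, which is summable. Hence the weighted series is finite
  almost everywhere, its terms are eventually below 1, and the bound 2^(-n) on \<open>d n\<close>
  makes the telescoping series converge.\<close>

lemma L2_fast_Cauchy_AE_convergent:
  assumes g: "\<And>n. g n \<in> L2"
    and le: "\<And>n. L2_norm (\<lambda>x. g (Suc n) x - g n x) \<le> C * (1 / 4) ^ n"
  shows "AE x in Rplus. convergent (\<lambda>n. g n x)"
proof -
  define d where "d n x = g (Suc n) x - g n x" for n x
  have d: "d n \<in> L2" for n unfolding d_def by (intro L2_diff g)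
  have [measurable]: "d n \<in> borel_measurable Rplus" for n using d by (simp add: L2_def)
  have C: "C \<ge> 0" using order_trans[OF L2_norm_nonneg le[of 0]] by simp
  have "(\<integral>\<^sup>+x. (\<Sum>n. ennreal (4 ^ n * (cmod (d n x))\<^sup>2)) \<partial>Rplus) =
      (\<Sum>n. \<integral>\<^sup>+x. ennreal (4 ^ n * (cmod (d n x))\<^sup>2) \<partial>Rplus)"
    by (rule nn_integral_suminf) measurable
  also have "\<dots> \<le> (\<Sum>n. ennreal (C\<^sup>2 * (1 / 4) ^ n))"
  proof (rule suminf_le)
    fix n
    have "(\<integral>\<^sup>+x. ennreal (4 ^ n * (cmod (d n x))\<^sup>2) \<partial>Rplus) = ennreal (4 ^ n) * ennreal ((L2_norm (d n))\<^sup>2)"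
      unfolding nn_integral_L2_norm[OF d, symmetric] by (simp add: ennreal_mult nn_integral_cmult)
    also have "\<dots> = ennreal (4 ^ n * (L2_norm (d n))\<^sup>2)" by (simp add: ennreal_mult)
    also have "\<dots> \<le> ennreal (4 ^ n * (C * (1 / 4) ^ n)\<^sup>2)"
      using le[of n] unfolding d_def[symmetric]
      by (intro ennreal_leI mult_left_mono power_mono) auto
    also have "4 ^ n * (C * (1 / 4) ^ n)\<^sup>2 = C\<^sup>2 * (1 / 4) ^ n"
      by (simp add: power_mult_distrib power2_eq_square power_one_over field_simps)
    finally show "(\<integral>\<^sup>+x. ennreal (4 ^ n * (cmod (d n x))\<^sup>2) \<partial>Rplus) \<le> ennreal (C\<^sup>2 * (1 / 4) ^ n)" .
  qed auto
  also have "\<dots> < \<infinity>"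
  proof -
    have "summable (\<lambda>n. C\<^sup>2 * (1 / 4 :: real) ^ n)" by (intro summable_mult summable_geometric) auto
    then show ?thesis by (subst suminf_ennreal2) auto
  qed
  finally have "AE x in Rplus. (\<Sum>n. ennreal (4 ^ n * (cmod (d n x))\<^sup>2)) \<noteq> \<infinity>"
    by (intro nn_integral_PInf_AE) auto
  then show ?thesis
  proof eventually_elim
    case (elim x)
    then have "summable (\<lambda>n. 4 ^ n * (cmod (d n x))\<^sup>2)"
      by (intro summable_suminf_not_top) auto
    then have "(\<lambda>n. 4 ^ n * (cmod (d n x))\<^sup>2) \<longlonglongrightarrow> 0" by (rule summable_LIMSEQ_zero)
    then have "\<forall>\<^sub>F n in sequentially. 4 ^ n * (cmod (d n x))\<^sup>2 < 1" by (rule order_tendstoD) simp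
    then have "\<forall>\<^sub>F n in sequentially. norm (d n x) \<le> (1 / 2) ^ n"
    proof eventually_elim
      case (elim n)
      have "(4 :: real) ^ n = (2 ^ n)\<^sup>2" by (simp add: power2_eq_square flip: power_mult_distrib)
      then have "(2 ^ n * cmod (d n x))\<^sup>2 \<le> 1\<^sup>2" using elim by (simp add: power_mult_distrib)
      then have "2 ^ n * cmod (d n x) \<le> 1" by (rule power2_le_imp_le) simp
      then show ?case by (simp add: power_one_over field_simps)
    qed
    moreover have "summable (\<lambda>n. (1 / 2 :: real) ^ n)" by (intro summable_geometric) auto
    ultimately have "summable (\<lambda>n. d n x)"
      by (rule summable_comparison_test_ev)
    then show ?case unfolding d_def by (rule convergent_if_summable_diff)
  qed
qed

text \<open>The estimate is asserted against every h, not just along an approximating sequence. In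
  this form it determines g almost everywhere and contains boundedness (h = 0) and the extension
  property (h = f).\<close>

lemma laplace_limit_exists:
  assumes \<theta>: "\<theta> \<in> {-pi/2..pi/2}" and K: "laplace_bound \<theta> K" and f: "f \<in> L2"
  shows "\<exists>g\<in>L2. \<forall>h\<in>L1 \<inter> L2. L2_norm (\<lambda>x. g x - laplace \<theta> h x) \<le> K * L2_norm (\<lambda>x. f x - h x)"
proof -
  have K_pos: "K \<ge> 0" using K laplace_bound_iff[OF \<theta>] sharp_const_pos[of \<theta>] by simp
  have "\<exists>h. h \<in> L1 \<inter> L2 \<and> L2_norm (\<lambda>x. f x - h x) \<le> (1 / 4) ^ n" for n
    using L1_L2_dense[OF f, of "(1 / 4) ^ n"] by (metis less_imp_le zero_less_divide_1_iff zero_less_numeral zero_less_power)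
  then obtain h where h: "\<And>n. h n \<in> L1 \<inter> L2" and fh: "\<And>n. L2_norm (\<lambda>x. f x - h n x) \<le> (1 / 4) ^ n"
    by metis
  have Lh: "laplace \<theta> u \<in> L2" if "u \<in> L1 \<inter> L2" for u using K that by (simp add: laplace_bound_def)
  have [measurable]: "laplace \<theta> u \<in> borel_measurable Rplus" if "u \<in> L1 \<inter> L2" for u
    using Lh[OF that] by (simp add: L2_def)
  have fast: "L2_norm (\<lambda>x. laplace \<theta> (h (Suc n)) x - laplace \<theta> (h n) x) \<le> (2 * K) * (1 / 4) ^ n" for n
  proof -
    have "L2_norm (\<lambda>x. h (Suc n) x - h n x) \<le> L2_norm (\<lambda>x. h (Suc n) x - f x) + L2_norm (\<lambda>x. h n x - f x)"
      using h f by (intro L2_triangle) auto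
    also have "\<dots> \<le> (1 / 4) ^ Suc n + (1 / 4) ^ n"
      using fh[of "Suc n"] fh[of n] by (intro add_mono) (simp_all only: L2_norm_minus_commute[of _ f])
    also have "\<dots> \<le> 2 * (1 / 4) ^ n" by simp
    finally have "K * L2_norm (\<lambda>x. h (Suc n) x - h n x) \<le> K * (2 * (1 / 4) ^ n)"
      using K_pos by (intro mult_left_mono)
    then show ?thesis using laplace_bound_diff[OF \<theta> K h h, of "Suc n" n] by (simp add: mult_ac)
  qed
  \<comment> \<open>Where the sequence diverges, the value of \<open>lim\<close> is arbitrary; this
    concerns a null set only.\<close>
  define g where "g x = lim (\<lambda>n. laplace \<theta> (h n) x)" for x
  have lim: "AE x in Rplus. (\<lambda>n. laplace \<theta> (h n) x) \<longlonglongrightarrow> g x"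
    using L2_fast_Cauchy_AE_convergent[OF Lh[OF h] fast]
    by eventually_elim (simp add: g_def convergent_LIMSEQ_iff)
  have g_meas [measurable]: "g \<in> borel_measurable Rplus"
    unfolding g_def using h by (intro borel_measurable_lim_metric) measurable
  have bound: "(\<lambda>x. g x - laplace \<theta> u x) \<in> L2"
      "L2_norm (\<lambda>x. g x - laplace \<theta> u x) \<le> K * L2_norm (\<lambda>x. f x - u x)" if u: "u \<in> L1 \<inter> L2" for u
  proof -
    have 1: "(\<lambda>x. laplace \<theta> (h n) x - laplace \<theta> u x) \<in> L2" for n by (intro L2_diff Lh h u)
    have 2: "L2_norm (\<lambda>x. laplace \<theta> (h n) x - laplace \<theta> u x) \<le> K * ((1 / 4) ^ n + L2_norm (\<lambda>x. f x - u x))" for n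
    proof -
      have "L2_norm (\<lambda>x. h n x - u x) \<le> L2_norm (\<lambda>x. h n x - f x) + L2_norm (\<lambda>x. u x - f x)"
        using h f u by (intro L2_triangle) auto
      also have "\<dots> \<le> (1 / 4) ^ n + L2_norm (\<lambda>x. f x - u x)"
        using fh[of n] by (simp only: L2_norm_minus_commute[of _ f])
      finally show ?thesis
        using laplace_bound_diff[OF \<theta> K h u, of n] K_pos by (meson mult_left_mono order_trans)
    qed
    have 3: "(\<lambda>n. K * ((1 / 4) ^ n + L2_norm (\<lambda>x. f x - u x))) \<longlonglongrightarrow> K * (0 + L2_norm (\<lambda>x. f x - u x))"
      by (intro tendsto_intros LIMSEQ_power_zero) auto
    have 4: "(\<lambda>x. g x - laplace \<theta> u x) \<in> borel_measurable Rplus" using u by measurable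
    have 5: "AE x in Rplus. (\<lambda>n. laplace \<theta> (h n) x - laplace \<theta> u x) \<longlonglongrightarrow> g x - laplace \<theta> u x"
      using lim by eventually_elim (intro tendsto_intros)
    show "(\<lambda>x. g x - laplace \<theta> u x) \<in> L2"
      "L2_norm (\<lambda>x. g x - laplace \<theta> u x) \<le> K * L2_norm (\<lambda>x. f x - u x)"
      using L2_fatou[OF 1 2 3 4 5] by simp_all
  qed
  \<comment> \<open>The case u = 0 of \<open>bound\<close> says that g itself is in L2.\<close>
  have "(\<lambda>_. 0) \<in> L1 \<inter> L2" by (simp add: L1_def L2_def)
  from bound(1)[OF this] have "g \<in> L2" by (simp add: laplace_def)
  then show ?thesis using bound(2) by blast
qed

lemma nonpos_if_le_mult_epsilon:
  fixes a C :: real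
  assumes "\<And>e. e > 0 \<Longrightarrow> a \<le> C * e"
  shows "a \<le> 0"
proof (rule tendsto_lowerbound)
  show "((\<lambda>e. C * e) \<longlongrightarrow> 0) (at_right 0)" by (intro tendsto_eq_intros) auto
  show "\<forall>\<^sub>F e in at_right 0. a \<le> C * e"
    using assms by (auto simp: eventually_at_right_less intro: eventually_mono[OF eventually_at_right_less])
qed simp

text \<open>A common approximant at every scale e puts g1 and g2 within (A + B) e of each other.
  Uniqueness, linearity and compatibility with equality almost everywhere are all reduced to this
  form.\<close>

lemma AE_eq_if_approx:
  assumes g1: "g1 \<in> L2" and g2: "g2 \<in> L2"
    and le: "\<And>e. e > 0 \<Longrightarrow> \<exists>u\<in>L2. L2_norm (\<lambda>x. g1 x - u x) \<le> A * e \<and> L2_norm (\<lambda>x. g2 x - u x) \<le> B * e"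
  shows "AE x in Rplus. g1 x = g2 x"
proof (rule AE_eq_if_L2_norm_le_0[OF g1 g2], rule nonpos_if_le_mult_epsilon)
  fix e :: real assume "e > 0"
  then obtain u where "u \<in> L2" "L2_norm (\<lambda>x. g1 x - u x) \<le> A * e" "L2_norm (\<lambda>x. g2 x - u x) \<le> B * e"
    using le by blast
  then show "L2_norm (\<lambda>x. g1 x - g2 x) \<le> (A + B) * e"
    using L2_triangle[OF g1 g2, of u] by (simp add: distrib_right)
qed

text \<open>Additivity applied to f = h + (f - h) turns the difference into T (f - h), up to a null
  set.\<close>

lemma laplace_extension_approx:
  assumes \<theta>: "\<theta> \<in> {-pi/2..pi/2}" and T: "laplace_extension \<theta> T"
  obtains C where "C \<ge> 0" "\<And>f h. f \<in> L2 \<Longrightarrow> h \<in> L1 \<inter> L2 \<Longrightarrow>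
      L2_norm (\<lambda>x. T f x - laplace \<theta> h x) \<le> C * L2_norm (\<lambda>x. f x - h x)"
proof -
  have T_L2: "\<And>f. f \<in> L2 \<Longrightarrow> T f \<in> L2"
    and T_add: "\<And>f g. f \<in> L2 \<Longrightarrow> g \<in> L2 \<Longrightarrow> AE x in Rplus. T (\<lambda>y. f y + g y) x = T f x + T g x"
    and T_L: "\<And>h. h \<in> L1 \<inter> L2 \<Longrightarrow> AE x in Rplus. T h x = laplace \<theta> h x"
    using T by (auto simp: laplace_extension_def bounded_L2_operator_def)
  have "\<exists>C. \<forall>f\<in>L2. L2_norm (T f) \<le> C * L2_norm f"
    using T by (simp add: laplace_extension_def bounded_L2_operator_def)
  then obtain C where C: "\<And>f. f \<in> L2 \<Longrightarrow> L2_norm (T f) \<le> C * L2_norm f"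
    by blast
  \<comment> \<open>\<open>max C 0\<close> supplies the nonnegative constant that the later
    monotonicity steps use.\<close>
  have "L2_norm (\<lambda>x. T f x - laplace \<theta> h x) \<le> max C 0 * L2_norm (\<lambda>x. f x - h x)"
    if f: "f \<in> L2" and h: "h \<in> L1 \<inter> L2" for f h
  proof -
    have h2: "h \<in> L2" using h by simp
    have fh: "(\<lambda>x. f x - h x) \<in> L2" by (rule L2_diff[OF f h2])
    have ae: "AE x in Rplus. T f x - laplace \<theta> h x = T (\<lambda>x. f x - h x) x"
      using T_add[OF h2 fh] T_L[OF h] by eventually_elim simp
    have "T f \<in> borel_measurable Rplus" "laplace \<theta> h \<in> borel_measurable Rplus"
      using T_L2[OF f] h2 laplace_measurable by (auto simp: L2_def)
    then have "(\<lambda>x. T f x - laplace \<theta> h x) \<in> borel_measurable Rplus" by measurable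
    from L2_norm_AE_cong(2)[OF T_L2[OF fh] this ae]
    have "L2_norm (\<lambda>x. T f x - laplace \<theta> h x) = L2_norm (T (\<lambda>x. f x - h x))" .
    also have "\<dots> \<le> C * L2_norm (\<lambda>x. f x - h x)" by (rule C[OF fh])
    also have "\<dots> \<le> max C 0 * L2_norm (\<lambda>x. f x - h x)" by (intro mult_right_mono) auto
    finally show ?thesis .
  qed
  then show ?thesis using that[of "max C 0"] by auto
qed

lemma laplace_extension_unique:
  assumes \<theta>: "\<theta> \<in> {-pi/2..pi/2}" and T: "laplace_extension \<theta> T" "laplace_extension \<theta> T'" and f: "f \<in> L2"
  shows "AE x in Rplus. T' f x = T f x"
proof -
  obtain C where C: "C \<ge> 0" "\<And>f h. f \<in> L2 \<Longrightarrow> h \<in> L1 \<inter> L2 \<Longrightarrow>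
      L2_norm (\<lambda>x. T f x - laplace \<theta> h x) \<le> C * L2_norm (\<lambda>x. f x - h x)"
    using laplace_extension_approx[OF \<theta> T(1)] by blast
  obtain C' where C': "C' \<ge> 0" "\<And>f h. f \<in> L2 \<Longrightarrow> h \<in> L1 \<inter> L2 \<Longrightarrow>
      L2_norm (\<lambda>x. T' f x - laplace \<theta> h x) \<le> C' * L2_norm (\<lambda>x. f x - h x)"
    using laplace_extension_approx[OF \<theta> T(2)] by blast
  show ?thesis
  proof (rule AE_eq_if_approx)
    show "T f \<in> L2" "T' f \<in> L2" using T f by (auto simp: laplace_extension_def bounded_L2_operator_def)
    fix e :: real assume "e > 0"
    then obtain h where h: "h \<in> L1 \<inter> L2" "L2_norm (\<lambda>x. f x - h x) < e"
      using L1_L2_dense[OF f] by blast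
    have "laplace \<theta> h \<in> L2" using laplace_bound_sharp_const[OF \<theta>] h(1) by (auto simp: laplace_bound_def)
    moreover have "L2_norm (\<lambda>x. T f x - laplace \<theta> h x) \<le> C * e"
      using C(2)[OF f h(1)] h(2) C(1) by (meson less_imp_le mult_left_mono order_trans)
    moreover have "L2_norm (\<lambda>x. T' f x - laplace \<theta> h x) \<le> C' * e"
      using C'(2)[OF f h(1)] h(2) C'(1) by (meson less_imp_le mult_left_mono order_trans)
    ultimately show "\<exists>u\<in>L2. L2_norm (\<lambda>x. T' f x - u x) \<le> C' * e \<and> L2_norm (\<lambda>x. T f x - u x) \<le> C * e"
      by blast
  qed
qed

text \<open>The images are chosen separately for each f, so linearity is claimed only almost
  everywhere; it is recovered by density from the estimate that defines the choice.\<close>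

lemma laplace_extension_exists:
  assumes \<theta>: "\<theta> \<in> {-pi/2..pi/2}"
  shows "\<exists>T. laplace_extension \<theta> T"
proof -
  define K where "K = sharp_const \<theta>"
  have K: "laplace_bound \<theta> K" "K \<ge> 0"
    using laplace_bound_sharp_const[OF \<theta>] sharp_const_pos[of \<theta>] by (auto simp: K_def)
  define T where "T f = (SOME g. g \<in> L2 \<and> (\<forall>h\<in>L1 \<inter> L2.
      L2_norm (\<lambda>x. g x - laplace \<theta> h x) \<le> K * L2_norm (\<lambda>x. f x - h x)))" for f
  have T: "T f \<in> L2" "\<And>h. h \<in> L1 \<inter> L2 \<Longrightarrow>
      L2_norm (\<lambda>x. T f x - laplace \<theta> h x) \<le> K * L2_norm (\<lambda>x. f x - h x)" if "f \<in> L2" for f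
    using someI_ex[OF laplace_limit_exists[OF \<theta> K(1) that, unfolded Bex_def]]
    unfolding T_def[symmetric] by auto
  have L: "laplace \<theta> h \<in> L2" if "h \<in> L1 \<inter> L2" for h using K that by (auto simp: laplace_bound_def)
  have near: "L2_norm (\<lambda>x. T f x - laplace \<theta> h x) \<le> K * e"
    if "f \<in> L2" "h \<in> L1 \<inter> L2" "L2_norm (\<lambda>x. f x - h x) \<le> e" for f h e
    using T(2)[OF that(1,2)] that(3) K(2) by (meson mult_left_mono order_trans)
  have zero: "(\<lambda>_. 0) \<in> L1 \<inter> L2" by (simp add: L1_def L2_def)
  have "bounded_L2_operator T"
    unfolding bounded_L2_operator_def
  proof (intro conjI ballI allI impI)
    show "T f \<in> L2" if "f \<in> L2" for f using that by (rule T)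
  next
    fix f g assume f: "f \<in> L2" and g: "g \<in> L2" and eq: "AE x in Rplus. f x = g x"
    show "AE x in Rplus. T f x = T g x"
    proof (rule AE_eq_if_approx[OF T(1)[OF f] T(1)[OF g]])
      fix e :: real assume "e > 0"
      then obtain h where h: "h \<in> L1 \<inter> L2" "L2_norm (\<lambda>x. f x - h x) < e"
        using L1_L2_dense[OF f] by blast
      have fh: "(\<lambda>x. f x - h x) \<in> L2" and gh: "(\<lambda>x. g x - h x) \<in> L2" using f g h by (auto intro: L2_diff)
      have "L2_norm (\<lambda>x. g x - h x) = L2_norm (\<lambda>x. f x - h x)"
        by (rule L2_norm_AE_cong[OF fh]) (use gh eq in \<open>auto simp: L2_def\<close>)
      then show "\<exists>u\<in>L2. L2_norm (\<lambda>x. T f x - u x) \<le> K * e \<and> L2_norm (\<lambda>x. T g x - u x) \<le> K * e"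
        using near[OF f h(1)] near[OF g h(1)] h(2) L[OF h(1)] by (auto intro!: bexI[of _ "laplace \<theta> h"])
    qed
  next
    fix f g assume f: "f \<in> L2" and g: "g \<in> L2"
    have fg: "(\<lambda>y. f y + g y) \<in> L2" and Tfg: "(\<lambda>y. T f y + T g y) \<in> L2"
      using f g T(1) by (auto intro: L2_add)
    show "AE x in Rplus. T (\<lambda>y. f y + g y) x = T f x + T g x"
    proof (rule AE_eq_if_approx[OF T(1)[OF fg] Tfg])
      fix e :: real assume e: "e > 0"
      obtain h where h: "h \<in> L1 \<inter> L2" "L2_norm (\<lambda>x. f x - h x) < e"
        using L1_L2_dense[OF f e] by blast
      obtain k where k: "k \<in> L1 \<inter> L2" "L2_norm (\<lambda>x. g x - k x) < e"
        using L1_L2_dense[OF g e] by blast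
      have hk: "(\<lambda>x. h x + k x) \<in> L1 \<inter> L2" by (rule L1_L2_closed[OF h(1) k(1)])
      have "(\<lambda>x. f x - h x) \<in> L2" "(\<lambda>x. g x - k x) \<in> L2" using f g h k by (auto intro: L2_diff)
      from L2_add(2)[OF this]
      have "L2_norm (\<lambda>x. (f x + g x) - (h x + k x)) \<le> 2 * e"
        using h(2) k(2) by (simp add: algebra_simps)
      then have "L2_norm (\<lambda>x. T (\<lambda>y. f y + g y) x - laplace \<theta> (\<lambda>x. h x + k x) x) \<le> K * (2 * e)"
        by (intro near[OF fg hk])
      moreover have "L2_norm (\<lambda>x. (T f x + T g x) - laplace \<theta> (\<lambda>x. h x + k x) x) \<le> K * e + K * e"
      proof -
        have "(\<lambda>x. T f x - laplace \<theta> h x) \<in> L2" "(\<lambda>x. T g x - laplace \<theta> k x) \<in> L2"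
          using T(1) f g L h(1) k(1) by (auto intro!: L2_diff)
        from L2_add(2)[OF this]
        have "L2_norm (\<lambda>x. (T f x - laplace \<theta> h x) + (T g x - laplace \<theta> k x)) \<le> K * e + K * e"
          using near[OF f h(1), of e] near[OF g k(1), of e] h(2) k(2) by linarith
        moreover have "L2_norm (\<lambda>x. (T f x + T g x) - laplace \<theta> (\<lambda>x. h x + k x) x) =
            L2_norm (\<lambda>x. (T f x - laplace \<theta> h x) + (T g x - laplace \<theta> k x))"
          unfolding L2_norm_def using h(1) k(1)
          by (intro arg_cong[where f = sqrt] Bochner_Integration.integral_cong refl)
            (simp add: laplace_linear[OF \<theta>] algebra_simps)
        ultimately show ?thesis by simp
      qed
      ultimately show "\<exists>u\<in>L2. L2_norm (\<lambda>x. T (\<lambda>y. f y + g y) x - u x) \<le> (2 * K) * e \<and>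
          L2_norm (\<lambda>x. (T f x + T g x) - u x) \<le> (2 * K) * e"
        using L[OF hk] by (intro bexI[of _ "laplace \<theta> (\<lambda>x. h x + k x)"]) (auto simp: algebra_simps)
    qed
  next
    fix c f assume f: "f \<in> L2"
    have cf: "(\<lambda>y. c * f y) \<in> L2" and Tcf: "(\<lambda>y. c * T f y) \<in> L2"
      using f T(1) by (auto intro: L2_cmult)
    show "AE x in Rplus. T (\<lambda>y. c * f y) x = c * T f x"
    proof (rule AE_eq_if_approx[OF T(1)[OF cf] Tcf])
      fix e :: real assume e: "e > 0"
      obtain h where h: "h \<in> L1 \<inter> L2" "L2_norm (\<lambda>x. f x - h x) < e"
        using L1_L2_dense[OF f e] by blast
      have ch: "(\<lambda>x. c * h x) \<in> L1 \<inter> L2" by (rule L1_L2_closed(3)[OF h(1) h(1)])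
      have fh: "(\<lambda>x. f x - h x) \<in> L2" using f h by (auto intro: L2_diff)
      have "L2_norm (\<lambda>x. c * f x - c * h x) \<le> cmod c * e"
        using L2_cmult(2)[OF fh, of c] h(2) by (simp add: right_diff_distrib mult_left_mono)
      then have "L2_norm (\<lambda>x. T (\<lambda>y. c * f y) x - laplace \<theta> (\<lambda>x. c * h x) x) \<le> K * (cmod c * e)"
        by (rule near[OF cf ch])
      moreover have "L2_norm (\<lambda>x. c * T f x - laplace \<theta> (\<lambda>x. c * h x) x) \<le> cmod c * (K * e)"
      proof -
        have "(\<lambda>x. T f x - laplace \<theta> h x) \<in> L2" using T(1)[OF f] L[OF h(1)] by (rule L2_diff)
        from L2_cmult(2)[OF this, of c] show ?thesis
          using near[OF f h(1), of e] h(2) by (simp add: laplace_cmult right_diff_distrib mult_left_mono)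
      qed
      ultimately show "\<exists>u\<in>L2. L2_norm (\<lambda>x. T (\<lambda>y. c * f y) x - u x) \<le> (K * cmod c) * e \<and>
          L2_norm (\<lambda>x. c * T f x - u x) \<le> (K * cmod c) * e"
        using L[OF ch] by (intro bexI[of _ "laplace \<theta> (\<lambda>x. c * h x)"]) (auto simp: mult_ac)
    qed
  next
    have "L2_norm (T f) \<le> K * L2_norm f" if "f \<in> L2" for f
      using T(2)[OF that zero] by (simp add: laplace_def)
    then show "\<exists>C. \<forall>f\<in>L2. L2_norm (T f) \<le> C * L2_norm f" by blast
  qed
  moreover have "AE \<rho> in Rplus. T f \<rho> = laplace \<theta> f \<rho>" if f: "f \<in> L1 \<inter> L2" for f
  proof (rule AE_eq_if_L2_norm_le_0)
    show "T f \<in> L2" "laplace \<theta> f \<in> L2" using f T(1) L by auto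
    show "L2_norm (\<lambda>x. T f x - laplace \<theta> f x) \<le> 0"
      using T(2)[of f f] f by (simp add: L2_norm_def)
  qed
  ultimately show ?thesis unfolding laplace_extension_def by blast
qed

text \<open>The upper bound extends by density, through approximants whose norm does not exceed that
  of f. For the lower bound, the operator norm is itself an admissible constant for the transform,
  so \<open>laplace_bound_iff\<close> applies to it.\<close>

lemma laplace_extension_onorm:
  assumes \<theta>: "\<theta> \<in> {-pi/2..pi/2}" and T: "laplace_extension \<theta> T"
  shows "L2_onorm T = sharp_const \<theta>"
proof -
  define K where "K = sharp_const \<theta>"
  have K: "laplace_bound \<theta> K" "K \<ge> 0"
    using laplace_bound_sharp_const[OF \<theta>] sharp_const_pos[of \<theta>] by (auto simp: K_def)
  have T_L2: "\<And>f. f \<in> L2 \<Longrightarrow> T f \<in> L2"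
    and T_L: "\<And>h. h \<in> L1 \<inter> L2 \<Longrightarrow> AE x in Rplus. T h x = laplace \<theta> h x"
    using T by (auto simp: laplace_extension_def bounded_L2_operator_def)
  obtain C where C: "C \<ge> 0" "\<And>f h. f \<in> L2 \<Longrightarrow> h \<in> L1 \<inter> L2 \<Longrightarrow>
      L2_norm (\<lambda>x. T f x - laplace \<theta> h x) \<le> C * L2_norm (\<lambda>x. f x - h x)"
    using laplace_extension_approx[OF \<theta> T] by blast
  have le: "L2_norm (T f) \<le> K * L2_norm f" if f: "f \<in> L2" for f
  proof -
    have "L2_norm (T f) - K * L2_norm f \<le> C * e" if e: "e > 0" for e
    proof -
      obtain h where h: "h \<in> L1 \<inter> L2" "L2_norm (\<lambda>x. f x - h x) < e" "L2_norm h \<le> L2_norm f"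
        using L1_L2_dense[OF f e] by blast
      have L: "laplace \<theta> h \<in> L2" "L2_norm (laplace \<theta> h) \<le> K * L2_norm h"
        using K h(1) by (auto simp: laplace_bound_def)
      have "L2_norm (T f) = L2_norm (\<lambda>x. (T f x - laplace \<theta> h x) + laplace \<theta> h x)" by simp
      also have "\<dots> \<le> L2_norm (\<lambda>x. T f x - laplace \<theta> h x) + L2_norm (laplace \<theta> h)"
        by (rule L2_add(2)[OF L2_diff(1)[OF T_L2[OF f] L(1)] L(1)])
      also have "\<dots> \<le> C * e + K * L2_norm f"
        using C(2)[OF f h(1)] mult_left_mono[OF less_imp_le[OF h(2)] C(1)] L(2) mult_left_mono[OF h(3) K(2)]
        by linarith
      finally show ?thesis by simp
    qed
    then have "L2_norm (T f) - K * L2_norm f \<le> 0" by (rule nonpos_if_le_mult_epsilon)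
    then show ?thesis by simp
  qed
  have quot: "L2_norm (T f) / L2_norm f \<le> K" if "f \<in> L2" for f
    using le[OF that] K(2) L2_norm_nonneg[of f]
    by (cases "L2_norm f = 0") (auto simp: pos_divide_le_eq less_le)
  have bdd: "bdd_above ((\<lambda>f. L2_norm (T f) / L2_norm f) ` L2)" using quot by (intro bdd_aboveI2)
  have "laplace_bound \<theta> (L2_onorm T)"
    unfolding laplace_bound_def
  proof
    fix f assume f: "f \<in> L1 \<inter> L2"
    then have L: "laplace \<theta> f \<in> L2" using K by (auto simp: laplace_bound_def)
    have f2: "f \<in> L2" using f by simp
    have eq: "L2_norm (laplace \<theta> f) = L2_norm (T f)"
    proof (rule L2_norm_AE_cong[OF T_L2[OF f2]])
      show "laplace \<theta> f \<in> borel_measurable Rplus" using L by (simp add: L2_def)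
      show "AE x in Rplus. laplace \<theta> f x = T f x" using T_L[OF f] by eventually_elim simp
    qed
    have "L2_norm (T f) / L2_norm f \<le> L2_onorm T"
      unfolding L2_onorm_def using f2 by (intro cSUP_upper bdd) auto
    \<comment> \<open>When the norm of f is 0, the quotient is 0 by convention and carries no
      information; \<open>le\<close> then shows that the norm of T f is 0.\<close>
    then have "L2_norm (T f) \<le> L2_onorm T * L2_norm f"
      using le[OF f2] L2_norm_nonneg[of f] L2_norm_nonneg[of "T f"]
      by (cases "L2_norm f = 0") (auto simp: pos_divide_le_eq less_le)
    then show "laplace \<theta> f \<in> L2 \<and> L2_norm (laplace \<theta> f) \<le> L2_onorm T * L2_norm f"
      using L eq by simp
  qed
  then have "K \<le> L2_onorm T" using laplace_bound_iff[OF \<theta>] by (simp add: K_def)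
  moreover have "L2_onorm T \<le> K"
    unfolding L2_onorm_def
  proof (rule cSUP_least)
    have "(\<lambda>_. 0) \<in> L2" by (simp add: L2_def)
    then show "L2 \<noteq> {}" by blast
  qed (rule quot)
  ultimately show ?thesis by (simp add: K_def)
qed

theorem theorem1:
  shows "(\<forall>\<theta>\<in>{-pi/2..pi/2}.
            (\<exists>K. laplace_bound \<theta> K) \<and>
            (\<exists>T. laplace_extension \<theta> T \<and>
               (\<forall>T'. laplace_extension \<theta> T' \<longrightarrow>
                  (\<forall>f\<in>L2. AE \<rho> in Rplus. T' f \<rho> = T f \<rho>)))) \<and>
         (\<forall>\<theta>\<in>{-pi/2..pi/2}.
            laplace_bound \<theta> (K1 \<theta>) \<and>
            (\<forall>K. laplace_bound \<theta> K \<longrightarrow> K1 \<theta> \<le> K) \<and>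
            (\<forall>T. laplace_extension \<theta> T \<longrightarrow> L2_onorm T = K1 \<theta>) \<and>
            (\<bar>\<theta>\<bar> < pi/2 \<longrightarrow>
               (let \<mu> = \<bar>\<theta>\<bar> / (pi/2) in
                  K1 \<theta> = sqrt pi * (1 - \<mu>) powr ((1 - \<mu>) / 4) * (1 + \<mu>) powr ((1 + \<mu>) / 4))) \<and>
            (\<bar>\<theta>\<bar> = pi/2 \<longrightarrow> K1 \<theta> = sqrt (2 * pi))) \<and>
         (\<forall>\<theta>\<in>{-pi/2..pi/2}. K1 (-\<theta>) = K1 \<theta>) \<and>
         strict_mono_on {0..pi/2} K1 \<and>
         continuous_on {0..pi/2} K1 \<and>
         (SUP \<theta>\<in>{-pi/2..pi/2}. K1 \<theta>) = sqrt (2 * pi)"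
proof (intro conjI ballI allI impI)
  fix \<theta> assume \<theta>: "\<theta> \<in> {-pi/2..pi/2}"
  note K1 = K1_eq[OF \<theta>]
  show "\<exists>K. laplace_bound \<theta> K" using laplace_bound_sharp_const[OF \<theta>] by blast
  show "\<exists>T. laplace_extension \<theta> T \<and> (\<forall>T'. laplace_extension \<theta> T' \<longrightarrow>
      (\<forall>f\<in>L2. AE \<rho> in Rplus. T' f \<rho> = T f \<rho>))"
    using laplace_extension_exists[OF \<theta>] laplace_extension_unique[OF \<theta>] by blast
  show "laplace_bound \<theta> (K1 \<theta>)" unfolding K1 by (rule laplace_bound_sharp_const[OF \<theta>])
  show "K1 \<theta> \<le> K" if "laplace_bound \<theta> K" for K using that laplace_bound_iff[OF \<theta>] by (simp add: K1)
  show "L2_onorm T = K1 \<theta>" if "laplace_extension \<theta> T" for T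
    using laplace_extension_onorm[OF \<theta> that] by (simp add: K1)
  show "let \<mu> = \<bar>\<theta>\<bar> / (pi/2) in
      K1 \<theta> = sqrt pi * (1 - \<mu>) powr ((1 - \<mu>) / 4) * (1 + \<mu>) powr ((1 + \<mu>) / 4)" if "\<bar>\<theta>\<bar> < pi/2"
    unfolding Let_def K1 by (rule sharp_const_powr[OF that refl])
  show "K1 \<theta> = sqrt (2 * pi)" if "\<bar>\<theta>\<bar> = pi/2" unfolding K1 by (rule sharp_const_half_pi[OF that])
  have "- \<theta> \<in> {-pi/2..pi/2}" using \<theta> by auto
  then show "K1 (- \<theta>) = K1 \<theta>" using K1_eq[of "- \<theta>"] by (simp add: K1 sharp_const_def)
next
  have eq: "K1 \<theta> = sharp_const \<theta>" if "\<theta> \<in> {0..pi/2}" for \<theta> using that by (intro K1_eq) auto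
  show "strict_mono_on {0..pi/2} K1"
    using strict_mono_on_sharp_const by (simp add: strict_mono_on_def eq)
  have "continuous_on {0..pi/2} sharp_const"
    by (rule continuous_on_subset[OF continuous_on_sharp_const]) auto
  then show "continuous_on {0..pi/2} K1" by (subst continuous_on_cong[OF refl eq])
  show "(SUP \<theta>\<in>{-pi/2..pi/2}. K1 \<theta>) = sqrt (2 * pi)"
  proof (rule cSup_eq_maximum)
    have "K1 (pi / 2) = sqrt (2 * pi)" using sharp_const_half_pi[of "pi / 2"] by (simp add: K1_eq)
    then show "sqrt (2 * pi) \<in> K1 ` {-pi/2..pi/2}" by (intro image_eqI[of _ _ "pi / 2"]) auto
  qed (use sharp_const_le in \<open>auto simp: K1_eq\<close>)
qed

end
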